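(* Let $(A,\ast)$ be a finite-dimensional Zinbiel algebra, $r=\sum_ix_i\otimes y_i\in A\otimes A$ a symmetric solution of the Zinbiel Yang-Baxter equation in $(A,\ast)$, $(B,\diamond,\omega)$ a finite-dimensional quadratic perm algebra, $\{e_1,\dots,e_n\}$ a basis of $B$ and $\{f_1,\dots,f_n\}$ the dual basis with respect to $\omega$, i.e. $\omega(f_i,e_j)=\delta_{ij}$. Let $(A\otimes B,\cdot)$ be the induced commutative associative algebra, with $(a_1\otimes b_1)(a_2\otimes b_2)=(a_1\ast a_2)\otimes(b_1\diamond b_2)+(a_2\ast a_1)\otimes(b_2\diamond b_1)$, and set $$\widehat r=\sum_i\sum_j(x_i\otimes e_j)\otimes(y_i\otimes f_j)\in(A\otimes B)\otimes(A\otimes B),\qquad \kappa=\sum_je_j\otimes f_j\in B\otimes B.$$ Then the $\mathcal O$-operator $\widehat r^{\,\sharp}:(A\otimes B)^*\to A\otimes B$ of $(A\otimes B,\cdot)$ associated to the representation $((A\otimes B)^*,-\mathbf u^*_{A\otimes B})$ is given by $$\widehat r^{\,\sharp}=r^\sharp\otimes\kappa^\sharp$$ (under the identification $(A\otimes B)^*=A^*\otimes B^*$).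
   Context: All vector spaces are over a field $\mathbf k$ of characteristic zero. A Zinbiel algebra $(A,\ast)$: $a_1\ast(a_2\ast a_3)=(a_1\ast a_2)\ast a_3+(a_2\ast a_1)\ast a_3$. A quadratic perm algebra $(B,\diamond,\omega)$: $b_1\diamond(b_2\diamond b_3)=(b_1\diamond b_2)\diamond b_3=(b_2\diamond b_1)\diamond b_3$, with $\omega$ an antisymmetric nondegenerate bilinear form satisfying $\omega(b_1\diamond b_2,b_3)=\omega(b_1,b_2\diamond b_3-b_3\diamond b_2)$. For any finite-dimensional $V$ and $s\in V\otimes V$, $s^\sharp:V^*\to V$ is defined by $\langle\xi_2,s^\sharp(\xi_1)\rangle=\langle\xi_1\otimes\xi_2,s\rangle$. Symmetric solution of the Zinbiel Yang-Baxter equation: $\tau(r)=r$ (with $\tau(x\otimes y)=y\otimes x$) and $\mathbf Z_r=0$; for symmetric $r$ one has $\mathbf Z_r=\sum_{i,j}\big(x_i\otimes x_j\otimes(y_i\ast y_j)+x_i\otimes x_j\otimes(y_j\ast y_i)-(x_i\ast x_j)\otimes y_i\otimes y_j-x_i\otimes(y_i\ast x_j)\otimes y_j\big)$. For a commutative associative algebra $C$, $\mathbf u_C(c)c'=cc'$, and $-\mathbf u_C^*:C\to\mathrm{End}(C^* )$ is given by $\langle(-\mathbf u_C^* )(c)\xi,c'\rangle=\langle\xi,cc'\rangle$. A linear map $\mathcal T:V\to C$ is an $\mathcal O$-operator of $C$ associated to a representation $(V,\mu)$ (i.e. $\mu(c_1)\mu(c_2)=\mu(c_1c_2)$) if $\mathcal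 T(v_1)\mathcal T(v_2)=\mathcal T\big(\mu(\mathcal T(v_1))v_2+\mu(\mathcal T(v_2))v_1\big)$ for all $v_1,v_2\in V$. *)

theory Defs
  imports Complex_Main "HOL-Library.Function_Algebras"
begin

section \<open>Vector spaces on carrier sets, duals and tensor products\<close>

text \<open>
  Dual spaces and tensor products live on proper subsets of function types, so a vector space is
  a subspace of an ambient, type-based vector space.
\<close>

record ('k, 'v) vec_space =
  carr :: "'v set"
  scl :: "'k \<Rightarrow> 'v \<Rightarrow> 'v"

locale vector_space_on =
  fixes V :: "('k::field, 'v::ab_group_add) vec_space"
  assumes ambient: "vector_space (scl V)"
    and subspace: "module.subspace (scl V) (carr V)"

definition fin_dim :: "('k::field, 'v::ab_group_add) vec_space \<Rightarrow> bool" where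
  "fin_dim V \<longleftrightarrow> (\<exists>S. finite S \<and> module.span (scl V) S = carr V)"

definition is_basis :: "('k::field, 'v::ab_group_add) vec_space \<Rightarrow> nat \<Rightarrow> (nat \<Rightarrow> 'v) \<Rightarrow> bool" where
  "is_basis V n e \<longleftrightarrow> inj_on e {..<n} \<and> \<not> module.dependent (scl V) (e ` {..<n}) \<and>
     module.span (scl V) (e ` {..<n}) = carr V"

definition linear_map ::
  "('k::field, 'v::ab_group_add) vec_space \<Rightarrow> ('k, 'w::ab_group_add) vec_space \<Rightarrow> ('v \<Rightarrow> 'w) \<Rightarrow> bool" where
  "linear_map V W f \<longleftrightarrow> (\<forall>x\<in>carr V. f x \<in> carr W) \<and>
     (\<forall>x\<in>carr V. \<forall>y\<in>carr V. f (x + y) = f x + f y) \<and>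
     (\<forall>c. \<forall>x\<in>carr V. f (scl V c x) = scl W c (f x))"

definition bilinear_map ::
  "('k::field, 'v::ab_group_add) vec_space \<Rightarrow> ('k, 'w::ab_group_add) vec_space \<Rightarrow>
   ('k, 'u::ab_group_add) vec_space \<Rightarrow> ('v \<Rightarrow> 'w \<Rightarrow> 'u) \<Rightarrow> bool" where
  "bilinear_map V W U f \<longleftrightarrow> (\<forall>v\<in>carr V. linear_map W U (f v)) \<and>
     (\<forall>w\<in>carr W. linear_map V U (\<lambda>v. f v w))"

definition scalars :: "('k::field, 'k) vec_space" where
  "scalars = \<lparr>carr = UNIV, scl = (*)\<rparr>"

definition fscale :: "'k::field \<Rightarrow> ('x \<Rightarrow> 'k) \<Rightarrow> ('x \<Rightarrow> 'k)" where
  "fscale c f = (\<lambda>x. c * f x)"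

text \<open>Functionals and bilinear forms are extended by 0 off the carriers, so that equality of
  functions is equality on the carriers.\<close>

definition dual :: "('k::field, 'v::ab_group_add) vec_space \<Rightarrow> ('k, 'v \<Rightarrow> 'k) vec_space" where
  "dual V = \<lparr>carr = {\<xi>. linear_map V scalars \<xi> \<and> (\<forall>x. x \<notin> carr V \<longrightarrow> \<xi> x = 0)}, scl = fscale\<rparr>"

definition bilinear_forms ::
  "('k::field, 'v::ab_group_add) vec_space \<Rightarrow> ('k, 'w::ab_group_add) vec_space \<Rightarrow> ('v \<Rightarrow> 'w \<Rightarrow> 'k) set" where
  "bilinear_forms V W = {\<beta>. bilinear_map V W scalars \<beta> \<and>
     (\<forall>v w. v \<notin> carr V \<or> w \<notin> carr W \<longrightarrow> \<beta> v w = 0)}"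

text \<open>
  As usual for vector spaces, the tensor product is realised inside the dual of the space of
  bilinear forms: the pure tensor of \<open>v\<close> and \<open>w\<close> is evaluation of forms at \<open>(v, w)\<close>, and the
  tensor product is the span of the pure tensors. Its universal property is lemmas
  \<open>bilinear_map_tens\<close>, \<open>tensor_lift_tens\<close>, \<open>linear_map_tensor_lift\<close> and \<open>linear_map_tensor_eqI\<close>
  below.
\<close>

type_synonym ('k, 'v, 'w) tensor = "('v \<Rightarrow> 'w \<Rightarrow> 'k) \<Rightarrow> 'k"

definition tens ::
  "('k::field, 'v::ab_group_add) vec_space \<Rightarrow> ('k, 'w::ab_group_add) vec_space \<Rightarrow>
   'v \<Rightarrow> 'w \<Rightarrow> ('k, 'v, 'w) tensor" where
  "tens V W v w = (\<lambda>\<beta>. if \<beta> \<in> bilinear_forms V W then \<beta> v w else 0)"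

definition tensor_space ::
  "('k::field, 'v::ab_group_add) vec_space \<Rightarrow> ('k, 'w::ab_group_add) vec_space \<Rightarrow>
   ('k, ('k, 'v, 'w) tensor) vec_space"  (infixr "\<otimes>\<^sub>V" 70) where
  "V \<otimes>\<^sub>V W = \<lparr>carr = module.span fscale {tens V W v w | v w. v \<in> carr V \<and> w \<in> carr W}, scl = fscale\<rparr>"

text \<open>
  The linear map on \<open>V \<otimes>\<^sub>V W\<close> induced by a bilinear map \<open>f\<close> into a space of functions: its value at
  the tensor \<open>t\<close>, evaluated at \<open>z\<close>, is \<open>t\<close> applied to the bilinear form \<open>f _ _ z\<close>.
\<close>

definition tensor_lift ::
  "('k::field, 'v::ab_group_add) vec_space \<Rightarrow> ('k, 'w::ab_group_add) vec_space \<Rightarrow>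
   ('v \<Rightarrow> 'w \<Rightarrow> ('z \<Rightarrow> 'k)) \<Rightarrow> ('k, 'v, 'w) tensor \<Rightarrow> ('z \<Rightarrow> 'k)" where
  "tensor_lift V W f t = (\<lambda>z. t (\<lambda>v w. if v \<in> carr V \<and> w \<in> carr W then f v w z else 0))"

definition tensor_map ::
  "('k::field, 'v::ab_group_add) vec_space \<Rightarrow> ('k, 'w::ab_group_add) vec_space \<Rightarrow>
   ('k, 'v2::ab_group_add) vec_space \<Rightarrow> ('k, 'w2::ab_group_add) vec_space \<Rightarrow>
   ('v \<Rightarrow> 'v2) \<Rightarrow> ('w \<Rightarrow> 'w2) \<Rightarrow> ('k, 'v, 'w) tensor \<Rightarrow> ('k, 'v2, 'w2) tensor" where
  "tensor_map V W V2 W2 f g = tensor_lift V W (\<lambda>v w. tens V2 W2 (f v) (g w))"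

definition tensor_flip ::
  "('k::field, 'v::ab_group_add) vec_space \<Rightarrow> ('k, 'w::ab_group_add) vec_space \<Rightarrow>
   ('k, 'v, 'w) tensor \<Rightarrow> ('k, 'w, 'v) tensor" where
  "tensor_flip V W = tensor_lift V W (\<lambda>v w. tens W V w v)"

text \<open>The functional \<open>\<xi> \<otimes> \<eta>\<close> on \<open>V \<otimes>\<^sub>V W\<close>, whose value at \<open>v \<otimes> w\<close> is \<open>\<xi> v * \<eta> w\<close>
  (lemma \<open>functional_tensor_tens\<close>).\<close>

definition functional_tensor ::
  "('k::field, 'v::ab_group_add) vec_space \<Rightarrow> ('k, 'w::ab_group_add) vec_space \<Rightarrow>
   ('v \<Rightarrow> 'k) \<Rightarrow> ('w \<Rightarrow> 'k) \<Rightarrow> ('k, 'v, 'w) tensor \<Rightarrow> 'k" where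
  "functional_tensor V W \<xi> \<eta> = (\<lambda>t. if t \<in> carr (V \<otimes>\<^sub>V W) then t (\<lambda>v w. \<xi> v * \<eta> w) else 0)"

text \<open>The identification of \<open>dual V \<otimes>\<^sub>V dual W\<close> with \<open>dual (V \<otimes>\<^sub>V W)\<close>.\<close>

definition dual_tensor_iso ::
  "('k::field, 'v::ab_group_add) vec_space \<Rightarrow> ('k, 'w::ab_group_add) vec_space \<Rightarrow>
   ('k, 'v \<Rightarrow> 'k, 'w \<Rightarrow> 'k) tensor \<Rightarrow> (('k, 'v, 'w) tensor \<Rightarrow> 'k)" where
  "dual_tensor_iso V W = tensor_lift (dual V) (dual W) (functional_tensor V W)"

definition sharp ::
  "('k::field, 'v::ab_group_add) vec_space \<Rightarrow> ('k, 'v, 'v) tensor \<Rightarrow> ('v \<Rightarrow> 'k) \<Rightarrow> 'v" where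
  "sharp V s \<xi>1 = (THE v. v \<in> carr V \<and>
     (\<forall>\<xi>2\<in>carr (dual V). \<xi>2 v = functional_tensor V V \<xi>1 \<xi>2 s))"

section \<open>Zinbiel algebras, quadratic perm algebras, O-operators\<close>

locale zinbiel_algebra = vector_space_on A
  for A :: "('k::field, 'a::ab_group_add) vec_space" +
  fixes zm :: "'a \<Rightarrow> 'a \<Rightarrow> 'a"
  assumes bilinear: "bilinear_map A A A zm"
    and zinbiel: "\<lbrakk>a1 \<in> carr A; a2 \<in> carr A; a3 \<in> carr A\<rbrakk> \<Longrightarrow>
      zm a1 (zm a2 a3) = zm (zm a1 a2) a3 + zm (zm a2 a1) a3"

locale perm_algebra = vector_space_on B
  for B :: "('k::field, 'b::ab_group_add) vec_space" +
  fixes pm :: "'b \<Rightarrow> 'b \<Rightarrow> 'b"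
  assumes bilinear: "bilinear_map B B B pm"
    and perm_assoc: "\<lbrakk>b1 \<in> carr B; b2 \<in> carr B; b3 \<in> carr B\<rbrakk> \<Longrightarrow>
      pm b1 (pm b2 b3) = pm (pm b1 b2) b3"
    and perm_left_comm: "\<lbrakk>b1 \<in> carr B; b2 \<in> carr B; b3 \<in> carr B\<rbrakk> \<Longrightarrow>
      pm (pm b1 b2) b3 = pm (pm b2 b1) b3"

locale quadratic_perm_algebra = perm_algebra B pm
  for B :: "('k::field, 'b::ab_group_add) vec_space" and pm :: "'b \<Rightarrow> 'b \<Rightarrow> 'b" +
  fixes \<omega> :: "'b \<Rightarrow> 'b \<Rightarrow> 'k"
  assumes form_bilinear: "bilinear_map B B scalars \<omega>"
    and form_antisym: "\<lbrakk>b1 \<in> carr B; b2 \<in> carr B\<rbrakk> \<Longrightarrow> \<omega> b1 b2 = - \<omega> b2 b1"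
    and form_nondegenerate: "\<lbrakk>b1 \<in> carr B; \<And>b2. b2 \<in> carr B \<Longrightarrow> \<omega> b1 b2 = 0\<rbrakk> \<Longrightarrow> b1 = 0"
    and form_invariant: "\<lbrakk>b1 \<in> carr B; b2 \<in> carr B; b3 \<in> carr B\<rbrakk> \<Longrightarrow>
      \<omega> (pm b1 b2) b3 = \<omega> b1 (pm b2 b3 - pm b3 b2)"

locale comm_assoc_algebra = vector_space_on C
  for C :: "('k::field, 'c::ab_group_add) vec_space" +
  fixes m :: "'c \<Rightarrow> 'c \<Rightarrow> 'c"
  assumes bilinear: "bilinear_map C C C m"
    and assoc: "\<lbrakk>c1 \<in> carr C; c2 \<in> carr C; c3 \<in> carr C\<rbrakk> \<Longrightarrow> m (m c1 c2) c3 = m c1 (m c2 c3)"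
    and comm: "\<lbrakk>c1 \<in> carr C; c2 \<in> carr C\<rbrakk> \<Longrightarrow> m c1 c2 = m c2 c1"

locale comm_assoc_representation = comm_assoc_algebra C m + V: vector_space_on V
  for C :: "('k::field, 'c::ab_group_add) vec_space" and m :: "'c \<Rightarrow> 'c \<Rightarrow> 'c"
    and V :: "('k, 'v::ab_group_add) vec_space" +
  fixes \<mu> :: "'c \<Rightarrow> 'v \<Rightarrow> 'v"
  assumes action_bilinear: "bilinear_map C V V \<mu>"
    and action_mult: "\<lbrakk>c1 \<in> carr C; c2 \<in> carr C; v \<in> carr V\<rbrakk> \<Longrightarrow> \<mu> c1 (\<mu> c2 v) = \<mu> (m c1 c2) v"

locale O_operator = comm_assoc_representation C m V \<mu>
  for C :: "('k::field, 'c::ab_group_add) vec_space" and m :: "'c \<Rightarrow> 'c \<Rightarrow> 'c"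
    and V :: "('k, 'v::ab_group_add) vec_space" and \<mu> :: "'c \<Rightarrow> 'v \<Rightarrow> 'v" +
  fixes T :: "'v \<Rightarrow> 'c"
  assumes linear: "linear_map V C T"
    and O_identity: "\<lbrakk>v1 \<in> carr V; v2 \<in> carr V\<rbrakk> \<Longrightarrow>
      m (T v1) (T v2) = T (\<mu> (T v1) v2 + \<mu> (T v2) v1)"

text \<open>The action called \<open>-u\<^sub>C\<^sup>*\<close>; with \<open>\<langle>u\<^sup>*(c) \<xi>, c'\<rangle> = - \<langle>\<xi>, u(c) c'\<rangle>\<close> the two signs cancel.\<close>

definition neg_u_dual ::
  "('k::field, 'c::ab_group_add) vec_space \<Rightarrow> ('c \<Rightarrow> 'c \<Rightarrow> 'c) \<Rightarrow> 'c \<Rightarrow> ('c \<Rightarrow> 'k) \<Rightarrow> ('c \<Rightarrow> 'k)" where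
  "neg_u_dual C m c \<xi> = (\<lambda>c'. if c' \<in> carr C then \<xi> (m c c') else 0)"

text \<open>The product on \<open>A \<otimes>\<^sub>V B\<close>, extended bilinearly from pure tensors
  (lemma \<open>induced_mult_tens\<close>).\<close>

definition induced_mult ::
  "('k::field, 'a::ab_group_add) vec_space \<Rightarrow> ('k, 'b::ab_group_add) vec_space \<Rightarrow>
   ('a \<Rightarrow> 'a \<Rightarrow> 'a) \<Rightarrow> ('b \<Rightarrow> 'b \<Rightarrow> 'b) \<Rightarrow>
   ('k, 'a, 'b) tensor \<Rightarrow> ('k, 'a, 'b) tensor \<Rightarrow> ('k, 'a, 'b) tensor" where
  "induced_mult A B zm pm s t =
     tensor_lift A B (\<lambda>a1 b1.
       tensor_lift A B (\<lambda>a2 b2.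
         tens A B (zm a1 a2) (pm b1 b2) + tens A B (zm a2 a1) (pm b2 b1)) t) s"

text \<open>The element \<open>Z\<^sub>r\<close> for the symmetric tensor \<open>r = \<Sum>i<N. x i \<otimes> y i\<close>.\<close>

definition zinbiel_YB ::
  "('k::field, 'a::ab_group_add) vec_space \<Rightarrow> ('a \<Rightarrow> 'a \<Rightarrow> 'a) \<Rightarrow> nat \<Rightarrow> (nat \<Rightarrow> 'a) \<Rightarrow> (nat \<Rightarrow> 'a) \<Rightarrow>
   ('k, 'a, ('k, 'a, 'a) tensor) tensor" where
  "zinbiel_YB A zm N x y =
     (let t3 = (\<lambda>a b c. tens A (A \<otimes>\<^sub>V A) a (tens A A b c)) in
      \<Sum>i<N. \<Sum>j<N. t3 (x i) (x j) (zm (y i) (y j)) + t3 (x i) (x j) (zm (y j) (y i))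
        - t3 (zm (x i) (x j)) (y i) (y j) - t3 (x i) (zm (y i) (x j)) (y j))"

section \<open>Basic facts\<close>

lemma vector_space_fscale: "vector_space fscale"
  by unfold_locales (auto simp: fscale_def fun_eq_iff algebra_simps)

interpretation fs: vector_space fscale
  by (rule vector_space_fscale)

lemma scl_tensor_space [simp]: "scl (V \<otimes>\<^sub>V W) = fscale"
  and scl_dual [simp]: "scl (dual V) = fscale"
  and scl_scalars [simp]: "scl scalars = (*)"
  and carr_scalars [simp]: "carr scalars = UNIV"
  by (simp_all add: tensor_space_def dual_def scalars_def)

lemma vector_space_on_tensor: "vector_space_on (V \<otimes>\<^sub>V W)"
  by (auto simp: vector_space_on_def tensor_space_def vector_space_fscale)

lemma tens_in_tensor_space: "v \<in> carr V \<Longrightarrow> w \<in> carr W \<Longrightarrow> tens V W v w \<in> carr (V \<otimes>\<^sub>V W)"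
  by (auto simp: tensor_space_def intro!: fs.span_base)

lemma bilinear_map_tens: "bilinear_map V W (V \<otimes>\<^sub>V W) (tens V W)"
proof -
  have "tens V W (x + y) w = tens V W x w + tens V W y w"
    "tens V W (scl V c x) w = fscale c (tens V W x w)"
    if "x \<in> carr V" "y \<in> carr V" "w \<in> carr W" for x y w c
    using that
    by (auto simp: tens_def fscale_def fun_eq_iff bilinear_forms_def bilinear_map_def linear_map_def)
  moreover have "tens V W v (x + y) = tens V W v x + tens V W v y"
    "tens V W v (scl W c x) = fscale c (tens V W v x)"
    if "x \<in> carr W" "y \<in> carr W" "v \<in> carr V" for x y v c
    using that
    by (auto simp: tens_def fscale_def fun_eq_iff bilinear_forms_def bilinear_map_def linear_map_def)
  ultimately show ?thesis
    by (auto simp: bilinear_map_def linear_map_def tens_in_tensor_space)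
qed

context vector_space_on
begin

lemma add_closed: "x \<in> carr V \<Longrightarrow> y \<in> carr V \<Longrightarrow> x + y \<in> carr V"
  and scale_closed: "x \<in> carr V \<Longrightarrow> scl V c x \<in> carr V"
  and zero_closed: "0 \<in> carr V"
proof -
  interpret v: vector_space "scl V" by (rule ambient)
  show "x \<in> carr V \<Longrightarrow> y \<in> carr V \<Longrightarrow> x + y \<in> carr V" "x \<in> carr V \<Longrightarrow> scl V c x \<in> carr V"
    "0 \<in> carr V"
    using subspace by (auto simp: v.subspace_def)
qed

end

lemma bilinear_form_slice:
  assumes "vector_space_on V" "vector_space_on W" "bilinear_map V W U f" "scl U = fscale"
  shows "(\<lambda>v w. if v \<in> carr V \<and> w \<in> carr W then f v w z else 0) \<in> bilinear_forms V W"
proof -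
  interpret V: vector_space_on V by fact
  interpret W: vector_space_on W by fact
  show ?thesis
    using assms(3,4) V.add_closed V.scale_closed W.add_closed W.scale_closed
    by (auto simp: bilinear_forms_def bilinear_map_def linear_map_def fscale_def)
qed

lemma tensor_lift_tens:
  assumes "vector_space_on V" "vector_space_on W" "bilinear_map V W U f" "scl U = fscale"
    and "v \<in> carr V" "w \<in> carr W"
  shows "tensor_lift V W f (tens V W v w) = f v w"
  using bilinear_form_slice[OF assms(1-4)] assms(5,6)
  by (simp add: tensor_lift_def tens_def fun_eq_iff)

lemma tensor_lift_add: "tensor_lift V W f (s + t) = tensor_lift V W f s + tensor_lift V W f t"
  and tensor_lift_fscale: "tensor_lift V W f (fscale c t) = fscale c (tensor_lift V W f t)"
  and tensor_lift_zero: "tensor_lift V W f 0 = 0"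
  by (simp_all add: tensor_lift_def fscale_def fun_eq_iff)

lemma tensor_induct [consumes 1, case_names zero step]:
  assumes "t \<in> carr (V \<otimes>\<^sub>V W)" and "P 0"
    and "\<And>c v w t. v \<in> carr V \<Longrightarrow> w \<in> carr W \<Longrightarrow> t \<in> carr (V \<otimes>\<^sub>V W) \<Longrightarrow> P t \<Longrightarrow>
      P (fscale c (tens V W v w) + t)"
  shows "P t"
proof -
  have "t \<in> fs.span {tens V W v w | v w. v \<in> carr V \<and> w \<in> carr W}"
    using assms(1) by (simp add: tensor_space_def)
  then have "t \<in> carr (V \<otimes>\<^sub>V W) \<and> P t"
  proof (induction rule: fs.span_induct_alt)
    case base
    then show ?case using vector_space_on.zero_closed[OF vector_space_on_tensor] assms(2) by blast
  next
    case (step c x y)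
    then obtain v w where vw: "v \<in> carr V" "w \<in> carr W" "x = tens V W v w" by blast
    then have "fscale c x \<in> carr (V \<otimes>\<^sub>V W)"
      using vector_space_on.scale_closed[OF vector_space_on_tensor tens_in_tensor_space, of v V w W c]
      by simp
    then have "fscale c x + y \<in> carr (V \<otimes>\<^sub>V W)"
      using step vector_space_on.add_closed[OF vector_space_on_tensor] by blast
    moreover have "P (fscale c x + y)"
      using step vw assms(3) by blast
    ultimately show ?case by (rule conjI)
  qed
  then show ?thesis by blast
qed

lemma linear_map_tensor_lift:
  assumes "vector_space_on V" "vector_space_on W" "vector_space_on U"
    and "bilinear_map V W U f" "scl U = fscale"
  shows "linear_map (V \<otimes>\<^sub>V W) U (tensor_lift V W f)"
proof -
  interpret U: vector_space_on U by fact
  have "tensor_lift V W f t \<in> carr U" if "t \<in> carr (V \<otimes>\<^sub>V W)" for t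
    using that
  proof (induction rule: tensor_induct)
    case zero
    show "tensor_lift V W f 0 \<in> carr U" by (simp only: tensor_lift_zero U.zero_closed)
  next
    case (step c v w t)
    have "f v w \<in> carr U"
      using assms(4) step by (auto simp: bilinear_map_def linear_map_def)
    then show "tensor_lift V W f (fscale c (tens V W v w) + t) \<in> carr U"
      using step U.add_closed U.scale_closed[of _ c] assms
      by (simp add: tensor_lift_add tensor_lift_fscale tensor_lift_tens[OF assms(1,2,4,5)])
  qed
  then show ?thesis
    by (simp add: linear_map_def tensor_lift_add tensor_lift_fscale assms(5))
qed

lemma linear_map_tensor_eqI:
  assumes "linear_map (V \<otimes>\<^sub>V W) U F" "linear_map (V \<otimes>\<^sub>V W) U G"
    and "\<And>v w. v \<in> carr V \<Longrightarrow> w \<in> carr W \<Longrightarrow> F (tens V W v w) = G (tens V W v w)"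
    and "t \<in> carr (V \<otimes>\<^sub>V W)"
  shows "F t = G t"
proof -
  interpret T: vector_space_on "V \<otimes>\<^sub>V W" by (rule vector_space_on_tensor)
  have *: "H (fscale c x) = scl U c (H x)" "y \<in> carr (V \<otimes>\<^sub>V W) \<Longrightarrow> H (x + y) = H x + H y"
    if "linear_map (V \<otimes>\<^sub>V W) U H" "x \<in> carr (V \<otimes>\<^sub>V W)" for H x y c
    using that by (auto simp: linear_map_def)
  have z: "H 0 = 0" if "linear_map (V \<otimes>\<^sub>V W) U H" for H
    using *(2)[OF that T.zero_closed T.zero_closed] by simp
  from assms(4) show ?thesis
  proof (induction rule: tensor_induct)
    case zero
    show "F 0 = G 0" by (simp only: z[OF assms(1)] z[OF assms(2)])
  next
    case (step c v w t)
    have x: "tens V W v w \<in> carr (V \<otimes>\<^sub>V W)" using step by (simp add: tens_in_tensor_space)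
    then have y: "fscale c (tens V W v w) \<in> carr (V \<otimes>\<^sub>V W)"
      using T.scale_closed[of _ c] by simp
    show "F (fscale c (tens V W v w) + t) = G (fscale c (tens V W v w) + t)"
      unfolding *(2)[OF assms(1) y step(3)] *(2)[OF assms(2) y step(3)]
        *(1)[OF assms(1) x] *(1)[OF assms(2) x] assms(3)[OF step(1,2)] step(4) ..
  qed
qed

lemma vector_space_on_dual: "vector_space_on (dual V)"
proof -
  have "fs.subspace (carr (dual V))"
    by (auto simp: fs.subspace_def dual_def linear_map_def fscale_def algebra_simps)
  then show ?thesis by (simp add: vector_space_on_def vector_space_fscale)
qed

lemma product_form:
  assumes "\<xi> \<in> carr (dual V)" "\<eta> \<in> carr (dual W)"
  shows "(\<lambda>v w. \<xi> v * \<eta> w) \<in> bilinear_forms V W"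
  using assms
  by (auto simp: bilinear_forms_def dual_def bilinear_map_def linear_map_def algebra_simps)

lemma functional_tensor_tens:
  assumes "\<xi> \<in> carr (dual V)" "\<eta> \<in> carr (dual W)" "v \<in> carr V" "w \<in> carr W"
  shows "functional_tensor V W \<xi> \<eta> (tens V W v w) = \<xi> v * \<eta> w"
  using assms product_form[OF assms(1,2)]
  by (simp add: functional_tensor_def tens_in_tensor_space) (simp add: tens_def)

lemma functional_tensor_in_dual: "functional_tensor V W \<xi> \<eta> \<in> carr (dual (V \<otimes>\<^sub>V W))"
proof -
  interpret T: vector_space_on "V \<otimes>\<^sub>V W" by (rule vector_space_on_tensor)
  show ?thesis
    using T.add_closed T.scale_closed
    by (auto simp: dual_def linear_map_def functional_tensor_def fscale_def)
qed

lemma tensor_apply_add: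
  assumes "t \<in> carr (V \<otimes>\<^sub>V W)" "\<beta> \<in> bilinear_forms V W" "\<gamma> \<in> bilinear_forms V W"
  shows "t (\<lambda>v w. \<beta> v w + \<gamma> v w) = t \<beta> + t \<gamma>"
proof -
  have "(\<lambda>v w. \<beta> v w + \<gamma> v w) \<in> bilinear_forms V W"
    using assms(2,3) by (auto simp: bilinear_forms_def bilinear_map_def linear_map_def algebra_simps)
  with assms show ?thesis
    by (induction rule: tensor_induct) (auto simp: tens_def fscale_def algebra_simps)
qed

lemma tensor_apply_scale:
  assumes "t \<in> carr (V \<otimes>\<^sub>V W)" "\<beta> \<in> bilinear_forms V W"
  shows "t (\<lambda>v w. c * \<beta> v w) = c * t \<beta>"
proof -
  have "(\<lambda>v w. c * \<beta> v w) \<in> bilinear_forms V W"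
    using assms(2) by (auto simp: bilinear_forms_def bilinear_map_def linear_map_def algebra_simps)
  with assms show ?thesis
    by (induction rule: tensor_induct) (auto simp: tens_def fscale_def algebra_simps)
qed

lemma bilinear_map_functional_tensor:
  "bilinear_map (dual V) (dual W) (dual (V \<otimes>\<^sub>V W)) (functional_tensor V W)"
proof -
  have 1: "functional_tensor V W (\<xi> + \<xi>') \<eta> = functional_tensor V W \<xi> \<eta> + functional_tensor V W \<xi>' \<eta>"
    if "\<xi> \<in> carr (dual V)" "\<xi>' \<in> carr (dual V)" "\<eta> \<in> carr (dual W)" for \<xi> \<xi>' \<eta>
  proof
    fix t
    have "(\<lambda>v w. (\<xi> + \<xi>') v * \<eta> w) = (\<lambda>v w. \<xi> v * \<eta> w + \<xi>' v * \<eta> w)"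
      by (simp add: fscale_def distrib_right fun_eq_iff)
    then show "(functional_tensor V W (\<xi> + \<xi>') \<eta>) t = (functional_tensor V W \<xi> \<eta> + functional_tensor V W \<xi>' \<eta>) t"
      using tensor_apply_add[OF _ product_form[OF that(1,3)] product_form[OF that(2,3)], of t]
      by (simp only: functional_tensor_def fscale_def plus_fun_apply) (simp add: fscale_def)
  qed
  have 2: "functional_tensor V W (fscale c \<xi>) \<eta> = fscale c (functional_tensor V W \<xi> \<eta>)"
    if "\<xi> \<in> carr (dual V)" "\<eta> \<in> carr (dual W)" for \<xi> \<eta> c
  proof
    fix t
    have "(\<lambda>v w. (fscale c \<xi>) v * \<eta> w) = (\<lambda>v w. c * (\<xi> v * \<eta> w))"
      by (simp add: fscale_def mult.assoc fun_eq_iff)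
    then show "(functional_tensor V W (fscale c \<xi>) \<eta>) t = (fscale c (functional_tensor V W \<xi> \<eta>)) t"
      using tensor_apply_scale[OF _ product_form[OF that], of t c]
      by (simp only: functional_tensor_def fscale_def plus_fun_apply) (simp add: fscale_def)
  qed
  have 3: "functional_tensor V W \<xi> (\<eta> + \<eta>') = functional_tensor V W \<xi> \<eta> + functional_tensor V W \<xi> \<eta>'"
    if "\<xi> \<in> carr (dual V)" "\<eta> \<in> carr (dual W)" "\<eta>' \<in> carr (dual W)" for \<xi> \<eta> \<eta>'
  proof
    fix t
    have "(\<lambda>v w. \<xi> v * (\<eta> + \<eta>') w) = (\<lambda>v w. \<xi> v * \<eta> w + \<xi> v * \<eta>' w)"
      by (simp add: fscale_def distrib_left fun_eq_iff)
    then show "(functional_tensor V W \<xi> (\<eta> + \<eta>')) t = (functional_tensor V W \<xi> \<eta> + functional_tensor V W \<xi> \<eta>') t"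
      using tensor_apply_add[OF _ product_form[OF that(1,2)] product_form[OF that(1,3)], of t]
      by (simp only: functional_tensor_def fscale_def plus_fun_apply) (simp add: fscale_def)
  qed
  have 4: "functional_tensor V W \<xi> (fscale c \<eta>) = fscale c (functional_tensor V W \<xi> \<eta>)"
    if "\<xi> \<in> carr (dual V)" "\<eta> \<in> carr (dual W)" for \<xi> \<eta> c
  proof
    fix t
    have "(\<lambda>v w. \<xi> v * (fscale c \<eta>) w) = (\<lambda>v w. c * (\<xi> v * \<eta> w))"
      by (simp add: fscale_def mult.left_commute fun_eq_iff)
    then show "(functional_tensor V W \<xi> (fscale c \<eta>)) t = (fscale c (functional_tensor V W \<xi> \<eta>)) t"
      using tensor_apply_scale[OF _ product_form[OF that], of t c]
      by (simp only: functional_tensor_def fscale_def plus_fun_apply) (simp add: fscale_def)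
  qed
  show ?thesis
    by (simp add: bilinear_map_def linear_map_def functional_tensor_in_dual 1 2 3 4)
qed

lemma dual_tensor_iso_tens:
  assumes "\<xi> \<in> carr (dual V)" "\<eta> \<in> carr (dual W)"
  shows "dual_tensor_iso V W (tens (dual V) (dual W) \<xi> \<eta>) = functional_tensor V W \<xi> \<eta>"
  unfolding dual_tensor_iso_def
  by (rule tensor_lift_tens[OF _ _ bilinear_map_functional_tensor])
     (use assms in \<open>auto simp: vector_space_on_dual\<close>)

lemma bilinear_map_swap: "bilinear_map V W U f \<Longrightarrow> bilinear_map W V U (\<lambda>w v. f v w)"
  by (auto simp: bilinear_map_def)

lemma tensor_map_tens:
  assumes "vector_space_on V" "vector_space_on W" "linear_map V V2 f" "linear_map W W2 g"
    and "v \<in> carr V" "w \<in> carr W"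
  shows "tensor_map V W V2 W2 f g (tens V W v w) = tens V2 W2 (f v) (g w)"
proof -
  have "bilinear_map V W (V2 \<otimes>\<^sub>V W2) (\<lambda>v w. tens V2 W2 (f v) (g w))"
    using bilinear_map_tens[of V2 W2] assms(3,4) by (auto simp: bilinear_map_def linear_map_def)
  then show ?thesis
    unfolding tensor_map_def using assms by (intro tensor_lift_tens) auto
qed

lemma tensor_flip_tens:
  assumes "vector_space_on V" "vector_space_on W" "v \<in> carr V" "w \<in> carr W"
  shows "tensor_flip V W (tens V W v w) = tens W V w v"
  unfolding tensor_flip_def
  by (rule tensor_lift_tens[OF _ _ bilinear_map_swap[OF bilinear_map_tens]]) (use assms in auto)

lemma induced_mult_tens:
  assumes A: "vector_space_on A" and B: "vector_space_on B"
    and zm: "bilinear_map A A A zm" and pm: "bilinear_map B B B pm"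
    and "a1 \<in> carr A" "a2 \<in> carr A" "b1 \<in> carr B" "b2 \<in> carr B"
  shows "induced_mult A B zm pm (tens A B a1 b1) (tens A B a2 b2) =
    tens A B (zm a1 a2) (pm b1 b2) + tens A B (zm a2 a1) (pm b2 b1)"
proof -
  interpret T: vector_space_on "A \<otimes>\<^sub>V B" by (rule vector_space_on_tensor)
  define g where "g = (\<lambda>a1 b1 a2 b2. tens A B (zm a1 a2) (pm b1 b2) + tens A B (zm a2 a1) (pm b2 b1))"
  note t = bilinear_map_tens[of A B, unfolded bilinear_map_def linear_map_def, simplified]
  note z = zm[unfolded bilinear_map_def linear_map_def] pm[unfolded bilinear_map_def linear_map_def]
  have inner: "bilinear_map A B (A \<otimes>\<^sub>V B) (g a1 b1)" if "a1 \<in> carr A" "b1 \<in> carr B" for a1 b1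
    using that t z T.add_closed
    by (simp add: bilinear_map_def linear_map_def g_def fs.scale_right_distrib add_ac)
  have il: "tensor_lift A B (g a1 b1) (tens A B a2 b2) = g a1 b1 a2 b2"
    if "a1 \<in> carr A" "b1 \<in> carr B" "a2 \<in> carr A" "b2 \<in> carr B" for a1 b1 a2 b2
    using tensor_lift_tens[OF A B inner[OF that(1,2)] _ that(3,4)] by simp
  have eq: "tensor_lift A B (\<lambda>a1 b1. tensor_lift A B (g a1 b1) (tens A B a2 b2)) =
      tensor_lift A B (\<lambda>a1 b1. g a1 b1 a2 b2)"
  proof (intro ext)
    fix t z
    have "(\<lambda>v w. if v \<in> carr A \<and> w \<in> carr B then tensor_lift A B (g v w) (tens A B a2 b2) z else 0) =
        (\<lambda>v w. if v \<in> carr A \<and> w \<in> carr B then g v w a2 b2 z else 0)"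
      by (intro ext if_cong refl) (metis il assms(6,8))
    then show "tensor_lift A B (\<lambda>a1 b1. tensor_lift A B (g a1 b1) (tens A B a2 b2)) t z =
        tensor_lift A B (\<lambda>a1 b1. g a1 b1 a2 b2) t z"
      by (simp only: tensor_lift_def[of A B "\<lambda>a1 b1. tensor_lift A B (g a1 b1) (tens A B a2 b2)"]
        tensor_lift_def[of A B "\<lambda>a1 b1. g a1 b1 a2 b2"])
  qed
  have outer: "bilinear_map A B (A \<otimes>\<^sub>V B) (\<lambda>a1 b1. g a1 b1 a2 b2)"
    using assms t z T.add_closed
    by (simp add: bilinear_map_def linear_map_def g_def fs.scale_right_distrib add_ac)
  have "induced_mult A B zm pm (tens A B a1 b1) (tens A B a2 b2) =
      tensor_lift A B (\<lambda>a1 b1. tensor_lift A B (g a1 b1) (tens A B a2 b2)) (tens A B a1 b1)"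
    by (simp add: induced_mult_def g_def)
  also have "\<dots> = g a1 b1 a2 b2"
    unfolding eq using tensor_lift_tens[OF A B outer] assms by simp
  finally show ?thesis by (simp add: g_def)
qed

end

theory Submission
  imports Defs
begin

text \<open>
  The formula for \<open>rh\<^sup>\<sharp>\<close> holds on pure tensors by definition, so the content is the
  \<open>\<O>\<close>-operator identity. It is tested against functionals: with \<open>T = rh\<^sup>\<sharp>\<close>, the number
  \<open>\<zeta> (T \<xi> \<cdot> T \<eta>)\<close> is \<open>L \<xi> \<eta> + L \<eta> \<xi>\<close>, where \<open>L\<close> only involves the first summand of the product
  on \<open>A \<otimes> B\<close>. On the other side, invariance of \<open>\<omega>\<close> moves every product in \<open>B\<close> from the second tensor
  slot to the third one, which gives \<open>\<zeta> (T (\<mu> (T \<xi>) \<eta>)) = P \<xi> \<eta> - R \<eta> \<xi>\<close>. Exchanging the last two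
  slots in \<open>Z\<^sub>r = 0\<close> and using the symmetry of \<open>r\<close> gives \<open>L \<xi> \<eta> = P \<xi> \<eta> - R \<xi> \<eta>\<close>, and both sides
  agree after symmetrisation in \<open>\<xi>\<close> and \<open>\<eta>\<close>.
\<close>

section \<open>Linear maps and tensors\<close>

lemma linear_mapI:
  assumes "\<And>x. x \<in> carr V \<Longrightarrow> f x \<in> carr W"
    and "\<And>x y. x \<in> carr V \<Longrightarrow> y \<in> carr V \<Longrightarrow> f (x + y) = f x + f y"
    and "\<And>c x. x \<in> carr V \<Longrightarrow> f (scl V c x) = scl W c (f x)"
  shows "linear_map V W f"
  using assms by (simp add: linear_map_def)

lemma
  assumes "linear_map V W f" "x \<in> carr V"
  shows linear_map_mem: "f x \<in> carr W"
    and linear_map_add: "y \<in> carr V \<Longrightarrow> f (x + y) = f x + f y"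
    and linear_map_scale: "f (scl V c x) = scl W c (f x)"
  using assms by (auto simp: linear_map_def)

lemma bilinear_map_right: "bilinear_map V W U f \<Longrightarrow> v \<in> carr V \<Longrightarrow> linear_map W U (f v)"
  and bilinear_map_left: "bilinear_map V W U f \<Longrightarrow> w \<in> carr W \<Longrightarrow> linear_map V U (\<lambda>v. f v w)"
  by (simp_all add: bilinear_map_def)

lemma bilinear_map_mem:
  "bilinear_map V W U f \<Longrightarrow> v \<in> carr V \<Longrightarrow> w \<in> carr W \<Longrightarrow> f v w \<in> carr U"
  by (rule linear_map_mem[OF bilinear_map_right])

lemma bilinear_mapI:
  assumes "\<And>v. v \<in> carr V \<Longrightarrow> linear_map W U (f v)"
    and "\<And>w. w \<in> carr W \<Longrightarrow> linear_map V U (\<lambda>v. f v w)"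
  shows "bilinear_map V W U f"
  using assms by (simp add: bilinear_map_def)

lemma linear_map_compose:
  "linear_map V W f \<Longrightarrow> linear_map W U g \<Longrightarrow> linear_map V U (\<lambda>v. g (f v))"
  by (simp add: linear_map_def)

lemma linear_map_plus:
  assumes "vector_space_on U" "linear_map V U f" "linear_map V U g"
  shows "linear_map V U (\<lambda>v. f v + g v)"
proof -
  interpret U: vector_space_on U by fact
  interpret u: vector_space "scl U" by (rule U.ambient)
  show ?thesis
    using assms(2,3) U.add_closed by (auto simp: linear_map_def u.scale_right_distrib algebra_simps)
qed

lemma linear_map_scaled:
  assumes "vector_space_on U" "linear_map V U f"
  shows "linear_map V U (\<lambda>v. scl U c (f v))"
proof -
  interpret U: vector_space_on U by fact
  interpret u: vector_space "scl U" by (rule U.ambient)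
  show ?thesis
    using assms(2) U.scale_closed
    by (auto simp: linear_map_def u.scale_right_distrib mult.commute)
qed

lemma linear_map_mult_left: "linear_map V scalars f \<Longrightarrow> linear_map V scalars (\<lambda>v. c * f v)"
  and linear_map_mult_right: "linear_map V scalars f \<Longrightarrow> linear_map V scalars (\<lambda>v. f v * c)"
  by (auto simp: linear_map_def algebra_simps)

lemma linear_map_cong:
  assumes "vector_space_on V" "linear_map V W f" "\<And>v. v \<in> carr V \<Longrightarrow> g v = f v"
  shows "linear_map V W g"
proof -
  interpret V: vector_space_on V by fact
  show ?thesis
    using assms(2,3) V.add_closed V.scale_closed by (simp add: linear_map_def)
qed

context vector_space_on
begin

lemma sum_closed: "(\<And>i. i \<in> I \<Longrightarrow> v i \<in> carr V) \<Longrightarrow> (\<Sum>i\<in>I. v i) \<in> carr V"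
  by (induction I rule: infinite_finite_induct) (auto simp: zero_closed add_closed)

lemma diff_closed: "x \<in> carr V \<Longrightarrow> y \<in> carr V \<Longrightarrow> x - y \<in> carr V"
proof -
  interpret v: vector_space "scl V" by (rule ambient)
  show "x \<in> carr V \<Longrightarrow> y \<in> carr V \<Longrightarrow> x - y \<in> carr V"
    using subspace by (rule v.subspace_diff)
qed

lemma linear_map_zero: "linear_map V W f \<Longrightarrow> f 0 = 0"
  using linear_map_add[of V W f 0 0] zero_closed by simp

lemma linear_map_sum:
  assumes "linear_map V W f" "\<And>i. i \<in> I \<Longrightarrow> v i \<in> carr V"
  shows "f (\<Sum>i\<in>I. v i) = (\<Sum>i\<in>I. f (v i))"
  using assms(2)
  by (induction I rule: infinite_finite_induct)
    (auto simp: linear_map_zero[OF assms(1)] linear_map_add[OF assms(1)] sum_closed)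

lemma linear_map_diff:
  assumes "linear_map V W f" "x \<in> carr V" "y \<in> carr V"
  shows "f (x - y) = f x - f y"
  using linear_map_add[OF assms(1) diff_closed[OF assms(2,3)] assms(3)] by simp

lemma linear_map_sum_scale:
  assumes "linear_map V W f" "\<And>i. i \<in> I \<Longrightarrow> v i \<in> carr V"
  shows "f (\<Sum>i\<in>I. scl V (c i) (v i)) = (\<Sum>i\<in>I. scl W (c i) (f (v i)))"
  using linear_map_sum[OF assms(1), of I "\<lambda>i. scl V (c i) (v i)"] assms
  by (simp add: scale_closed linear_map_scale[OF assms(1)])

lemma linear_combination:
  assumes "\<And>i. i \<in> I \<Longrightarrow> v i \<in> carr V" "\<And>i. i \<in> I \<Longrightarrow> linear_map U scalars (c i)"
  shows "linear_map U V (\<lambda>u. \<Sum>i\<in>I. scl V (c i u) (v i))"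
proof -
  interpret v: vector_space "scl V" by (rule ambient)
  show ?thesis
  proof (rule linear_mapI)
    show "(\<Sum>i\<in>I. scl V (c i x) (v i)) \<in> carr V" for x
      by (intro sum_closed scale_closed assms)
    show "(\<Sum>i\<in>I. scl V (c i (x + y)) (v i)) =
        (\<Sum>i\<in>I. scl V (c i x) (v i)) + (\<Sum>i\<in>I. scl V (c i y) (v i))"
      if "x \<in> carr U" "y \<in> carr U" for x y
      using that by (simp add: linear_map_add[OF assms(2)] v.scale_left_distrib sum.distrib)
    show "(\<Sum>i\<in>I. scl V (c i (scl U a x)) (v i)) = scl V a (\<Sum>i\<in>I. scl V (c i x) (v i))"
      if "x \<in> carr U" for x a
      using that by (simp add: linear_map_scale[OF assms(2)] v.scale_sum_right)
  qed
qed

text \<open>The map with value \<open>\<Sum>i\<in>I. scl V (c i v) (b i)\<close> is linear and fixes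
  every \<open>b j\<close>, so it is the identity on the span. The coefficients are left abstract
  because the bilinear form on \<open>B\<close> will supply them.\<close>

lemma spanning_expansion:
  assumes "module.span (scl V) (b ` I) = carr V" "finite I"
    and lin: "\<And>i. i \<in> I \<Longrightarrow> linear_map V scalars (c i)"
    and dual: "\<And>i j. i \<in> I \<Longrightarrow> j \<in> I \<Longrightarrow> c i (b j) = (if i = j then 1 else 0)"
    and "v \<in> carr V"
  shows "v = (\<Sum>i\<in>I. scl V (c i v) (b i))"
proof -
  interpret v: vector_space "scl V" by (rule ambient)
  have b: "b i \<in> carr V" if "i \<in> I" for i
    using that assms(1) v.span_base by blast
  let ?g = "\<lambda>v. \<Sum>i\<in>I. scl V (c i v) (b i)"
  have g: "linear_map V V ?g"
    using b lin by (rule linear_combination)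
  have "v \<in> v.span (b ` I)" using assms by simp
  then have "v \<in> carr V \<and> v = ?g v"
  proof (induction rule: v.span_induct_alt)
    case base
    show ?case using zero_closed linear_map_zero[OF g] by simp
  next
    case (step a x y)
    then obtain j where j: "j \<in> I" "x = b j" by blast
    have "?g x = (\<Sum>i\<in>I. if i = j then b i else 0)"
      unfolding j by (intro sum.cong refl) (simp add: dual j)
    then have "?g x = x" using j \<open>finite I\<close> by simp
    then show ?case
      using step b j linear_map_add[OF g, of "scl V a x" y] linear_map_scale[OF g, of x a]
      by (simp add: add_closed scale_closed)
  qed
  then show ?thesis by blast
qed

end

lemma bilinear_map_sum_scale:
  assumes "vector_space_on V" "vector_space_on W" "vector_space_on U" "bilinear_map V W U h"
    and "\<And>i. i \<in> I \<Longrightarrow> v i \<in> carr V" "\<And>j. j \<in> J \<Longrightarrow> w j \<in> carr W"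
  shows "h (\<Sum>i\<in>I. scl V (c i) (v i)) (\<Sum>j\<in>J. scl W (d j) (w j)) =
    (\<Sum>i\<in>I. \<Sum>j\<in>J. scl U (c i * d j) (h (v i) (w j)))"
proof -
  interpret V: vector_space_on V by fact
  interpret W: vector_space_on W by fact
  interpret U: vector_space_on U by fact
  interpret u: vector_space "scl U" by (rule U.ambient)
  have w: "(\<Sum>j\<in>J. scl W (d j) (w j)) \<in> carr W"
    by (intro W.sum_closed W.scale_closed assms)
  have "h (\<Sum>i\<in>I. scl V (c i) (v i)) (\<Sum>j\<in>J. scl W (d j) (w j)) =
      (\<Sum>i\<in>I. scl U (c i) (h (v i) (\<Sum>j\<in>J. scl W (d j) (w j))))"
    using assms(4,5) w by (intro V.linear_map_sum_scale) (simp_all add: bilinear_map_def)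
  also have "\<dots> = (\<Sum>i\<in>I. scl U (c i) (\<Sum>j\<in>J. scl U (d j) (h (v i) (w j))))"
    using assms(4,5,6)
    by (intro sum.cong refl arg_cong[of _ _ "scl U _"] W.linear_map_sum_scale)
      (auto simp: bilinear_map_def)
  finally show ?thesis by (simp add: u.scale_sum_right)
qed

section \<open>Functionals, separation of points and the sharp map\<close>

lemma dual_linear: "\<xi> \<in> carr (dual V) \<Longrightarrow> linear_map V scalars \<xi>"
  by (simp add: dual_def)

text \<open>Elements of \<open>dual V\<close> must vanish off the carrier, so a functional that is
  merely linear on \<open>carr V\<close> has to be cut off before it can be used as one of
  them.\<close>

lemma restrict_in_dual:
  assumes "vector_space_on V" "linear_map V scalars \<xi>"
  shows "(\<lambda>v. if v \<in> carr V then \<xi> v else 0) \<in> carr (dual V)"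
  using linear_map_cong[OF assms, of "\<lambda>v. if v \<in> carr V then \<xi> v else 0"] by (simp add: dual_def)

lemma dual_eqI:
  assumes "\<xi> \<in> carr (dual V)" "\<eta> \<in> carr (dual V)" "\<And>v. v \<in> carr V \<Longrightarrow> \<xi> v = \<eta> v"
  shows "\<xi> = \<eta>"
  using assms by (auto simp: dual_def fun_eq_iff) metis

text \<open>The definite description in \<open>sharp\<close> characterises a vector only through
  functionals. Uniqueness of that vector is exactly this separation property.\<close>

definition separated :: "('k::field, 'v::ab_group_add) vec_space \<Rightarrow> bool" where
  "separated V \<longleftrightarrow> (\<forall>v\<in>carr V. (\<forall>\<xi>\<in>carr (dual V). \<xi> v = 0) \<longrightarrow> v = 0)"

lemma separatedD:
  assumes "vector_space_on V" "separated V" "v \<in> carr V" "w \<in> carr V"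
    and "\<And>\<xi>. \<xi> \<in> carr (dual V) \<Longrightarrow> \<xi> v = \<xi> w"
  shows "v = w"
proof -
  interpret V: vector_space_on V by fact
  have "\<forall>\<xi>\<in>carr (dual V). \<xi> (v - w) = 0"
    using assms by (simp add: V.linear_map_diff[OF dual_linear])
  then show ?thesis
    using assms(2-4) V.diff_closed[of v w] by (auto simp: separated_def)
qed

text \<open>A tensor is itself a function, and evaluation at any argument is linear in the tensor. A
  tensor killed by all functionals is therefore 0 at every argument; no dimension count
  enters.\<close>

lemma separated_tensor: "separated (V \<otimes>\<^sub>V W)"
  unfolding separated_def
proof (intro ballI impI ext)
  fix t \<beta>
  assume t: "t \<in> carr (V \<otimes>\<^sub>V W)" "\<forall>\<xi>\<in>carr (dual (V \<otimes>\<^sub>V W)). \<xi> t = 0"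
  have "linear_map (V \<otimes>\<^sub>V W) scalars (\<lambda>t. t \<beta>)"
    by (simp add: linear_map_def fscale_def)
  from restrict_in_dual[OF vector_space_on_tensor this] t
  show "t \<beta> = 0 \<beta>" by fastforce
qed

lemma finite_dual_basis:
  assumes "vector_space_on V" "fin_dim V"
  obtains T \<alpha> where "finite T" "T \<subseteq> carr V" "\<And>t. t \<in> T \<Longrightarrow> \<alpha> t \<in> carr (dual V)"
    "\<And>v. v \<in> carr V \<Longrightarrow> v = (\<Sum>t\<in>T. scl V (\<alpha> t v) t)"
proof -
  interpret V: vector_space_on V by fact
  interpret v: vector_space "scl V" by (rule V.ambient)
  from assms(2) obtain S where S: "finite S" "v.span S = carr V" by (auto simp: fin_dim_def)
  \<comment> \<open>A finite spanning set is thinned out to a basis, which stays finite. The basis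
    is then indexed by its own elements.\<close>
  obtain T where T: "T \<subseteq> S" "v.independent T" "v.span T = v.span S"
    using v.maximal_independent_subset[of S] v.span_mono v.span_span
    by (metis v.span_eq v.span_superset subset_trans)
  define \<alpha> where "\<alpha> t v = (if v \<in> carr V then v.representation T v t else 0)" for t v
  have fin: "finite T" using T(1) S(1) finite_subset by blast
  have "linear_map V scalars (\<lambda>v. v.representation T v t)" for t
    using T S by (simp add: linear_map_def v.representation_add v.representation_scale)
  then have "\<alpha> t \<in> carr (dual V)" for t
    using restrict_in_dual[OF assms(1)] unfolding \<alpha>_def by blast
  moreover have "v = (\<Sum>t\<in>T. scl V (\<alpha> t v) t)" if "v \<in> carr V" for v
    using v.sum_representation_eq[OF T(2) _ fin order_refl, of v] that T S by (simp add: \<alpha>_def)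
  moreover have "T \<subseteq> carr V" using T S v.span_superset by blast
  ultimately show ?thesis using fin that by blast
qed

text \<open>If all functionals vanish at a vector, so do its coordinates in a finite dual basis, and
  the expansion is a sum of zeros.\<close>

lemma separated_fin_dim:
  assumes "vector_space_on V" "fin_dim V"
  shows "separated V"
proof -
  interpret v: vector_space "scl V" by (rule vector_space_on.ambient[OF assms(1)])
  obtain T \<alpha> where T: "finite T" "T \<subseteq> carr V" "\<And>t. t \<in> T \<Longrightarrow> \<alpha> t \<in> carr (dual V)"
    "\<And>v. v \<in> carr V \<Longrightarrow> v = (\<Sum>t\<in>T. scl V (\<alpha> t v) t)"
    using finite_dual_basis[OF assms] by metis
  show ?thesis
    unfolding separated_def using T(3,4) by (metis (no_types, lifting) sum.neutral v.scale_zero_left)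
qed

text \<open>This replaces the definite description by a formula: the right side has the required
  pairing with each functional, and separation makes it the only such vector.\<close>

lemma sharp_sum:
  assumes "vector_space_on V" "separated V" "\<xi> \<in> carr (dual V)"
    and "\<And>i. i \<in> I \<Longrightarrow> u i \<in> carr V" "\<And>i. i \<in> I \<Longrightarrow> w i \<in> carr V"
  shows "sharp V (\<Sum>i\<in>I. tens V V (u i) (w i)) \<xi> = (\<Sum>i\<in>I. scl V (\<xi> (u i)) (w i))"
proof -
  interpret V: vector_space_on V by fact
  interpret T: vector_space_on "V \<otimes>\<^sub>V V" by (rule vector_space_on_tensor)
  let ?v = "\<Sum>i\<in>I. scl V (\<xi> (u i)) (w i)"
  have v: "?v \<in> carr V" by (intro V.sum_closed V.scale_closed assms)
  have eq: "\<eta> ?v = functional_tensor V V \<xi> \<eta> (\<Sum>i\<in>I. tens V V (u i) (w i))"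
    if "\<eta> \<in> carr (dual V)" for \<eta>
  proof -
    have "functional_tensor V V \<xi> \<eta> (\<Sum>i\<in>I. tens V V (u i) (w i)) = (\<Sum>i\<in>I. \<xi> (u i) * \<eta> (w i))"
      using assms that
      by (subst T.linear_map_sum[OF dual_linear[OF functional_tensor_in_dual]])
        (simp_all add: tens_in_tensor_space functional_tensor_tens)
    moreover have "\<eta> ?v = (\<Sum>i\<in>I. \<xi> (u i) * \<eta> (w i))"
      using V.linear_map_sum_scale[OF dual_linear[OF that], of I w] assms by simp
    ultimately show ?thesis by simp
  qed
  show ?thesis
    unfolding sharp_def
    by (rule the_equality) (use v eq separatedD[OF assms(1,2)] in auto)
qed

lemma linear_map_sharp:
  assumes "vector_space_on V" "separated V"
    and "\<And>i. i \<in> I \<Longrightarrow> u i \<in> carr V" "\<And>i. i \<in> I \<Longrightarrow> w i \<in> carr V"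
  shows "linear_map (dual V) V (sharp V (\<Sum>i\<in>I. tens V V (u i) (w i)))"
proof (rule linear_map_cong[OF vector_space_on_dual])
  show "linear_map (dual V) V (\<lambda>\<xi>. \<Sum>i\<in>I. scl V (\<xi> (u i)) (w i))"
    by (rule vector_space_on.linear_combination) (auto simp: assms linear_map_def fscale_def)
qed (rule sharp_sum[OF assms(1,2) _ assms(3,4)])

section \<open>The identification of the dual of a tensor product\<close>

lemma sum_fun_apply: "(\<Sum>i\<in>I. f i) x = (\<Sum>i\<in>I. f i x)"
  by (induction I rule: infinite_finite_induct) simp_all

text \<open>This is the transpose of the expansion of vectors: apply \<open>\<xi>\<close> to the
  expansion of \<open>v\<close> and read the result as a function of \<open>v\<close>.\<close>

lemma dual_expansion:
  assumes "vector_space_on V" "S \<subseteq> carr V" "\<And>v. v \<in> carr V \<Longrightarrow> v = (\<Sum>s\<in>S. scl V (\<alpha> s v) s)"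
    and "\<And>s. s \<in> S \<Longrightarrow> \<alpha> s \<in> carr (dual V)" "\<xi> \<in> carr (dual V)"
  shows "\<xi> = (\<Sum>s\<in>S. scl (dual V) (\<xi> s) (\<alpha> s))"
proof -
  interpret V: vector_space_on V by fact
  interpret D: vector_space_on "dual V" by (rule vector_space_on_dual)
  show ?thesis
  proof (rule dual_eqI[OF assms(5)])
    show "(\<Sum>s\<in>S. scl (dual V) (\<xi> s) (\<alpha> s)) \<in> carr (dual V)"
      by (intro D.sum_closed D.scale_closed assms(4))
    show "\<xi> v = (\<Sum>s\<in>S. scl (dual V) (\<xi> s) (\<alpha> s)) v" if v: "v \<in> carr V" for v
    proof -
      have "\<xi> v = \<xi> (\<Sum>s\<in>S. scl V (\<alpha> s v) s)"
        using assms(3)[OF v] by simp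
      also have "\<dots> = (\<Sum>s\<in>S. \<alpha> s v * \<xi> s)"
        using V.linear_map_sum_scale[OF dual_linear[OF assms(5)], of S "\<lambda>s. s" "\<lambda>s. \<alpha> s v"] assms(2)
        by auto
      finally show ?thesis by (simp add: fscale_def sum_fun_apply mult.commute)
    qed
  qed
qed

lemma linear_map_dual_tensor_iso:
  "linear_map (dual V \<otimes>\<^sub>V dual W) (dual (V \<otimes>\<^sub>V W)) (dual_tensor_iso V W)"
  unfolding dual_tensor_iso_def
  by (rule linear_map_tensor_lift) (simp_all add: vector_space_on_dual bilinear_map_functional_tensor)

lemma bij_betw_dual_tensor_iso:
  assumes V: "vector_space_on V" "fin_dim V" and W: "vector_space_on W" "fin_dim W"
  shows "bij_betw (dual_tensor_iso V W) (carr (dual V \<otimes>\<^sub>V dual W)) (carr (dual (V \<otimes>\<^sub>V W)))"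
proof -
  interpret V: vector_space_on V by fact
  interpret W: vector_space_on W by fact
  interpret D: vector_space_on "dual V \<otimes>\<^sub>V dual W" by (rule vector_space_on_tensor)
  interpret T: vector_space_on "V \<otimes>\<^sub>V W" by (rule vector_space_on_tensor)
  obtain S \<alpha> where S: "finite S" "S \<subseteq> carr V" "\<And>s. s \<in> S \<Longrightarrow> \<alpha> s \<in> carr (dual V)"
    "\<And>v. v \<in> carr V \<Longrightarrow> v = (\<Sum>s\<in>S. scl V (\<alpha> s v) s)"
    using finite_dual_basis[OF V] by metis
  obtain T \<beta> where T: "finite T" "T \<subseteq> carr W" "\<And>t. t \<in> T \<Longrightarrow> \<beta> t \<in> carr (dual W)"
    "\<And>w. w \<in> carr W \<Longrightarrow> w = (\<Sum>t\<in>T. scl W (\<beta> t w) t)"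
    using finite_dual_basis[OF W] by metis
  let ?F = "dual_tensor_iso V W"
  \<comment> \<open>The inverse reads off the matrix of \<open>\<Phi>\<close> on products of basis
    vectors and rebuilds it from the dual bases. Both composites are compared with the identity on
    pure tensors only.\<close>
  define G where "G \<Phi> =
    (\<Sum>p\<in>S \<times> T. fscale (\<Phi> (tens V W (fst p) (snd p))) (tens (dual V) (dual W) (\<alpha> (fst p)) (\<beta> (snd p))))"
    for \<Phi>
  note F = linear_map_dual_tensor_iso[of V W]
  have dualt: "tens (dual V) (dual W) (\<alpha> (fst p)) (\<beta> (snd p)) \<in> carr (dual V \<otimes>\<^sub>V dual W)"
    if "p \<in> S \<times> T" for p
    using that S(3) T(3) by (auto intro: tens_in_tensor_space)
  have "linear_map (dual (V \<otimes>\<^sub>V W)) (dual V \<otimes>\<^sub>V dual W)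
      (\<lambda>\<Phi>. \<Sum>p\<in>S \<times> T. scl (dual V \<otimes>\<^sub>V dual W) (\<Phi> (tens V W (fst p) (snd p)))
        (tens (dual V) (dual W) (\<alpha> (fst p)) (\<beta> (snd p))))"
    using dualt by (rule D.linear_combination) (simp_all add: linear_map_def fscale_def)
  then have G: "linear_map (dual (V \<otimes>\<^sub>V W)) (dual V \<otimes>\<^sub>V dual W) G"
    unfolding G_def by simp
  note expand = dual_expansion[OF assms(1) S(2,4)] and expand' = dual_expansion[OF assms(3) T(2,4)]
  show ?thesis
  proof (rule bij_betw_byWitness[where f' = G])
    show "\<forall>\<zeta>\<in>carr (dual V \<otimes>\<^sub>V dual W). G (?F \<zeta>) = \<zeta>"
    proof
      fix \<zeta> assume "\<zeta> \<in> carr (dual V \<otimes>\<^sub>V dual W)"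
      then show "G (?F \<zeta>) = \<zeta>"
      proof (rule linear_map_tensor_eqI[OF linear_map_compose[OF F G], rotated 2])
        show "linear_map (dual V \<otimes>\<^sub>V dual W) (dual V \<otimes>\<^sub>V dual W) (\<lambda>\<zeta>. \<zeta>)"
          by (simp add: linear_map_def)
        fix \<xi> \<eta> assume h: "\<xi> \<in> carr (dual V)" "\<eta> \<in> carr (dual W)"
        have "G (?F (tens (dual V) (dual W) \<xi> \<eta>)) = (\<Sum>s\<in>S. \<Sum>t\<in>T.
            scl (dual V \<otimes>\<^sub>V dual W) (\<xi> s * \<eta> t) (tens (dual V) (dual W) (\<alpha> s) (\<beta> t)))"
          unfolding G_def sum.cartesian_product using S(2) T(2)
          by (intro sum.cong refl) (auto simp: dual_tensor_iso_tens h functional_tensor_tens subset_iff)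
        also have "\<dots> = tens (dual V) (dual W)
            (\<Sum>s\<in>S. scl (dual V) (\<xi> s) (\<alpha> s)) (\<Sum>t\<in>T. scl (dual W) (\<eta> t) (\<beta> t))"
          using S(3) T(3)
          by (subst bilinear_map_sum_scale[OF vector_space_on_dual vector_space_on_dual
                vector_space_on_tensor bilinear_map_tens]) auto
        finally show "G (?F (tens (dual V) (dual W) \<xi> \<eta>)) = tens (dual V) (dual W) \<xi> \<eta>"
          using expand[OF _ S(3) h(1)] expand'[OF _ T(3) h(2)] by simp
      qed
    qed
    show "\<forall>\<Phi>\<in>carr (dual (V \<otimes>\<^sub>V W)). ?F (G \<Phi>) = \<Phi>"
    proof
      fix \<Phi> assume \<Phi>: "\<Phi> \<in> carr (dual (V \<otimes>\<^sub>V W))"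
      have FG: "?F (G \<Phi>) \<in> carr (dual (V \<otimes>\<^sub>V W))"
        using linear_map_mem[OF F linear_map_mem[OF G \<Phi>]] .
      show "?F (G \<Phi>) = \<Phi>"
      proof (rule dual_eqI[OF FG \<Phi>])
        fix t assume "t \<in> carr (V \<otimes>\<^sub>V W)"
        then show "?F (G \<Phi>) t = \<Phi> t"
        proof (rule linear_map_tensor_eqI[OF dual_linear[OF FG] dual_linear[OF \<Phi>], rotated])
          fix v w assume vw: "v \<in> carr V" "w \<in> carr W"
          have "\<Phi> (tens V W v w) =
            \<Phi> (tens V W (\<Sum>s\<in>S. scl V (\<alpha> s v) s) (\<Sum>t\<in>T. scl W (\<beta> t w) t))"
            using S(4)[OF vw(1)] T(4)[OF vw(2)] by simp
          also have "\<dots> = \<Phi> (\<Sum>s\<in>S. \<Sum>t\<in>T. scl (V \<otimes>\<^sub>V W) (\<alpha> s v * \<beta> t w) (tens V W s t))"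
            using S(2) T(2) by (subst bilinear_map_sum_scale[OF assms(1,3) vector_space_on_tensor bilinear_map_tens]) auto
          also have "\<dots> = (\<Sum>p\<in>S \<times> T. \<alpha> (fst p) v * \<beta> (snd p) w * \<Phi> (tens V W (fst p) (snd p)))"
            unfolding sum.cartesian_product split_beta using S(2) T(2)
            by (subst T.linear_map_sum_scale[OF dual_linear[OF \<Phi>]]) (auto intro!: tens_in_tensor_space)
          also have "\<dots> = (\<Sum>p\<in>S \<times> T. fscale (\<Phi> (tens V W (fst p) (snd p))) (?F (tens (dual V) (dual W) (\<alpha> (fst p)) (\<beta> (snd p)))) (tens V W v w))"
            by (intro sum.cong refl)
              (auto simp: dual_tensor_iso_tens functional_tensor_tens S T vw fscale_def)
          also have "\<dots> = ?F (G \<Phi>) (tens V W v w)"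
            using D.linear_map_sum_scale[OF F dualt, where c = "\<lambda>p. \<Phi> (tens V W (fst p) (snd p))"]
            by (simp add: G_def sum_fun_apply)
          finally show "?F (G \<Phi>) (tens V W v w) = \<Phi> (tens V W v w)" ..
        qed
      qed
    qed
  qed (use F G in \<open>auto simp: linear_map_def\<close>)
qed

section \<open>The product on \<open>A \<otimes>\<^sub>V B\<close>\<close>

text \<open>This is the two-step extension behind \<open>induced_mult\<close>. Linearity in
  \<open>s\<close> is the universal property; linearity in \<open>t\<close> is less direct because
  \<open>t\<close> occurs inside the bilinear map that is lifted.\<close>

lemma bilinear_map_tensor_lift:
  assumes vs: "vector_space_on V" "vector_space_on W" "vector_space_on V'" "vector_space_on W'"
      "vector_space_on U"
    and right: "\<And>v w. v \<in> carr V \<Longrightarrow> w \<in> carr W \<Longrightarrow> bilinear_map V' W' U (g v w)"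
    and left: "\<And>v' w'. v' \<in> carr V' \<Longrightarrow> w' \<in> carr W' \<Longrightarrow> bilinear_map V W U (\<lambda>v w. g v w v' w')"
    and U: "scl U = fscale"
  shows "bilinear_map (V \<otimes>\<^sub>V W) (V' \<otimes>\<^sub>V W') U
    (\<lambda>s t. tensor_lift V W (\<lambda>v w. tensor_lift V' W' (g v w) t) s)"
proof -
  interpret V: vector_space_on V by fact
  interpret W: vector_space_on W by fact
  interpret U: vector_space_on U by fact
  interpret u: vector_space "scl U" by (rule U.ambient)
  note lift = linear_map_tensor_lift[OF vs(3-5) right U]
  have tens: "tensor_lift V' W' (g v w) (tens V' W' v' w') = g v w v' w'"
    if "v \<in> carr V" "w \<in> carr W" "v' \<in> carr V'" "w' \<in> carr W'" for v w v' w'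
    by (rule tensor_lift_tens[OF vs(3,4) right U]) (use that in auto)
  note scaled = linear_map_scaled[OF vs(5)]
  \<comment> \<open>For general \<open>t\<close> there is no formula in \<open>v\<close> and
    \<open>w\<close>. Each law is linear in \<open>t\<close>, so it suffices to check it on pure
    tensors, where it is the assumption \<open>left\<close>.\<close>
  have inner: "bilinear_map V W U (\<lambda>v w. tensor_lift V' W' (g v w) t)"
    if t: "t \<in> carr (V' \<otimes>\<^sub>V W')" for t
  proof (rule bilinear_mapI; rule linear_mapI)
    show "tensor_lift V' W' (g v w) t \<in> carr U" "tensor_lift V' W' (g v w) t \<in> carr U"
      if "v \<in> carr V" "w \<in> carr W" for v w
      using linear_map_mem[OF lift t] that by auto
    show "tensor_lift V' W' (g v (w1 + w2)) t =
        tensor_lift V' W' (g v w1) t + tensor_lift V' W' (g v w2) t"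
      if "v \<in> carr V" "w1 \<in> carr W" "w2 \<in> carr W" for v w1 w2
    proof (rule linear_map_tensor_eqI[OF lift linear_map_plus[OF vs(5) lift lift] _ t])
      fix v' w' assume h: "v' \<in> carr V'" "w' \<in> carr W'"
      then show "tensor_lift V' W' (g v (w1 + w2)) (tens V' W' v' w') =
          tensor_lift V' W' (g v w1) (tens V' W' v' w') + tensor_lift V' W' (g v w2) (tens V' W' v' w')"
        using that W.add_closed linear_map_add[OF bilinear_map_right[OF left[OF h]], of v w1 w2]
        by (simp add: tens)
    qed (use that W.add_closed in auto)
    show "tensor_lift V' W' (g v (scl W c w)) t = scl U c (tensor_lift V' W' (g v w) t)"
      if "v \<in> carr V" "w \<in> carr W" for v w c
    proof (rule linear_map_tensor_eqI[OF lift scaled[OF lift] _ t])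
      fix v' w' assume h: "v' \<in> carr V'" "w' \<in> carr W'"
      then show "tensor_lift V' W' (g v (scl W c w)) (tens V' W' v' w') =
          scl U c (tensor_lift V' W' (g v w) (tens V' W' v' w'))"
        using that W.scale_closed linear_map_scale[OF bilinear_map_right[OF left[OF h]], of v w c]
        by (simp add: tens)
    qed (use that W.scale_closed in auto)
    show "tensor_lift V' W' (g (v1 + v2) w) t =
        tensor_lift V' W' (g v1 w) t + tensor_lift V' W' (g v2 w) t"
      if "w \<in> carr W" "v1 \<in> carr V" "v2 \<in> carr V" for w v1 v2
    proof (rule linear_map_tensor_eqI[OF lift linear_map_plus[OF vs(5) lift lift] _ t])
      fix v' w' assume h: "v' \<in> carr V'" "w' \<in> carr W'"
      then show "tensor_lift V' W' (g (v1 + v2) w) (tens V' W' v' w') =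
          tensor_lift V' W' (g v1 w) (tens V' W' v' w') + tensor_lift V' W' (g v2 w) (tens V' W' v' w')"
        using that V.add_closed linear_map_add[OF bilinear_map_left[OF left[OF h]], of w v1 v2]
        by (simp add: tens)
    qed (use that V.add_closed in auto)
    show "tensor_lift V' W' (g (scl V c v) w) t = scl U c (tensor_lift V' W' (g v w) t)"
      if "w \<in> carr W" "v \<in> carr V" for v w c
    proof (rule linear_map_tensor_eqI[OF lift scaled[OF lift] _ t])
      fix v' w' assume h: "v' \<in> carr V'" "w' \<in> carr W'"
      then show "tensor_lift V' W' (g (scl V c v) w) (tens V' W' v' w') =
          scl U c (tensor_lift V' W' (g v w) (tens V' W' v' w'))"
        using that V.scale_closed linear_map_scale[OF bilinear_map_left[OF left[OF h]], of w v c]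
        by (simp add: tens)
    qed (use that V.scale_closed in auto)
  qed
  let ?m = "\<lambda>s t. tensor_lift V W (\<lambda>v w. tensor_lift V' W' (g v w) t) s"
  show ?thesis
  proof (rule bilinear_mapI)
    fix t assume t: "t \<in> carr (V' \<otimes>\<^sub>V W')"
    show "linear_map (V \<otimes>\<^sub>V W) U (\<lambda>s. ?m s t)"
      by (rule linear_map_tensor_lift[OF vs(1,2,5) inner[OF t] U])
  next
    fix s assume "s \<in> carr (V \<otimes>\<^sub>V W)"
    \<comment> \<open>Induction on \<open>s\<close>: the zero map is linear, and adding a scaled
      pure tensor to \<open>s\<close> adds a multiple of one inner lift, which is linear in
      \<open>t\<close>.\<close>
    then show "linear_map (V' \<otimes>\<^sub>V W') U (?m s)"
    proof (induction rule: tensor_induct)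
      case zero
      show ?case using U.zero_closed u.scale_zero_right
        by (simp only: tensor_lift_zero linear_map_def) simp
    next
      case (step c v w s)
      have eq: "?m (fscale c (tens V W v w) + s) t = scl U c (tensor_lift V' W' (g v w) t) + ?m s t"
        if "t \<in> carr (V' \<otimes>\<^sub>V W')" for t
        using tensor_lift_tens[OF vs(1,2) inner[OF that] U step(1,2)]
        by (simp only: tensor_lift_add tensor_lift_fscale U)
      show ?case
        by (rule linear_map_cong[OF vector_space_on_tensor
              linear_map_plus[OF vs(5) scaled[OF lift[OF step(1,2)]] step(4)] eq])
    qed
  qed
qed

locale zinbiel_perm = A: zinbiel_algebra A zm + B: perm_algebra B pm
  for A :: "('k::field, 'a::ab_group_add) vec_space" and zm
    and B :: "('k, 'b::ab_group_add) vec_space" and pm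
begin

abbreviation C where "C \<equiv> A \<otimes>\<^sub>V B"
abbreviation mult where "mult \<equiv> induced_mult A B zm pm"

lemmas zm_mem = bilinear_map_mem[OF A.bilinear]
lemmas pm_mem = bilinear_map_mem[OF B.bilinear]
lemmas mult_tens = induced_mult_tens[OF A.vector_space_on_axioms B.vector_space_on_axioms A.bilinear B.bilinear]

lemma bilinear_map_mult: "bilinear_map C C C mult"
proof -
  note tr = linear_map_compose[OF _ bilinear_map_right[OF bilinear_map_tens]]
  note tl = linear_map_compose[OF _ bilinear_map_left[OF bilinear_map_tens]]
  show ?thesis
    unfolding induced_mult_def
  proof (rule bilinear_map_tensor_lift)
    show "bilinear_map A B C (\<lambda>a2 b2. tens A B (zm a1 a2) (pm b1 b2) + tens A B (zm a2 a1) (pm b2 b1))"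
      if "a1 \<in> carr A" "b1 \<in> carr B" for a1 b1
      using that
      by (intro bilinear_mapI linear_map_plus vector_space_on_tensor tr tl)
        (auto intro!: zm_mem pm_mem bilinear_map_right[OF A.bilinear] bilinear_map_right[OF B.bilinear]
          bilinear_map_left[OF A.bilinear] bilinear_map_left[OF B.bilinear])
    show "bilinear_map A B C (\<lambda>a1 b1. tens A B (zm a1 a2) (pm b1 b2) + tens A B (zm a2 a1) (pm b2 b1))"
      if "a2 \<in> carr A" "b2 \<in> carr B" for a2 b2
      using that
      by (intro bilinear_mapI linear_map_plus vector_space_on_tensor tr tl)
        (auto intro!: zm_mem pm_mem bilinear_map_right[OF A.bilinear] bilinear_map_right[OF B.bilinear]
          bilinear_map_left[OF A.bilinear] bilinear_map_left[OF B.bilinear])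
  qed (auto simp: vector_space_on_tensor A.vector_space_on_axioms B.vector_space_on_axioms)
qed

lemmas mult_mem = bilinear_map_mem[OF bilinear_map_mult]
lemmas mult_left = bilinear_map_left[OF bilinear_map_mult]
lemmas mult_right = bilinear_map_right[OF bilinear_map_mult]

lemma mult_comm:
  assumes "s \<in> carr C" "t \<in> carr C"
  shows "mult s t = mult t s"
  using assms(1)
proof (rule linear_map_tensor_eqI[OF mult_left mult_right, rotated 3])
  fix a b assume ab: "a \<in> carr A" "b \<in> carr B"
  then have x: "tens A B a b \<in> carr C" by (rule tens_in_tensor_space)
  show "mult (tens A B a b) t = mult t (tens A B a b)"
    using assms(2)
    by (rule linear_map_tensor_eqI[OF mult_right mult_left, rotated 3])
      (use ab x in \<open>simp_all add: mult_tens add.commute\<close>)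
qed (use assms in auto)

text \<open>In a perm algebra a triple product depends only on its last factor, so only three
  elements of \<open>B\<close> occur. Associativity then amounts to comparing their three
  coefficients in \<open>A\<close>.\<close>

lemma mult_assoc_tens:
  assumes a: "a1 \<in> carr A" "a2 \<in> carr A" "a3 \<in> carr A" and b: "b1 \<in> carr B" "b2 \<in> carr B" "b3 \<in> carr B"
  shows "mult (mult (tens A B a1 b1) (tens A B a2 b2)) (tens A B a3 b3) =
    mult (tens A B a1 b1) (mult (tens A B a2 b2) (tens A B a3 b3))"
proof -
  let ?t = "tens A B"
  \<comment> \<open>The index of each constant is that of the factor standing last.\<close>
  define \<beta>1 \<beta>2 \<beta>3 where \<beta>: "\<beta>1 = pm b3 (pm b2 b1)" "\<beta>2 = pm b3 (pm b1 b2)" "\<beta>3 = pm b1 (pm b2 b3)"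
  have tens_add: "?t u b + ?t v b = ?t (u + v) b" if "u \<in> carr A" "v \<in> carr A" "b \<in> carr B" for u v b
    using linear_map_add[OF bilinear_map_left[OF bilinear_map_tens]] that by metis
  have \<beta>1: "pm (pm b2 b3) b1 = \<beta>1" "pm (pm b3 b2) b1 = \<beta>1"
    and \<beta>2: "pm b1 (pm b3 b2) = \<beta>2"
    and \<beta>3: "pm (pm b1 b2) b3 = \<beta>3" "pm (pm b2 b1) b3 = \<beta>3"
    unfolding \<beta> using b by (metis B.perm_assoc B.perm_left_comm)+
  \<comment> \<open>The right side of the Zinbiel identity is symmetric in its first two
    arguments.\<close>
  have left_comm: "zm u (zm v w) = zm v (zm u w)" if "u \<in> carr A" "v \<in> carr A" "w \<in> carr A" for u v w
    using that by (simp add: A.zinbiel add.commute)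
  have "mult (mult (?t a1 b1) (?t a2 b2)) (?t a3 b3) =
      ?t (zm (zm a1 a2) a3) \<beta>3 + ?t (zm a3 (zm a1 a2)) \<beta>2 +
      (?t (zm (zm a2 a1) a3) \<beta>3 + ?t (zm a3 (zm a2 a1)) \<beta>1)"
    using a b linear_map_add[OF mult_left, of "?t a3 b3" "?t (zm a1 a2) (pm b1 b2)" "?t (zm a2 a1) (pm b2 b1)"]
    by (simp add: mult_tens tens_in_tensor_space zm_mem pm_mem \<beta>3) (simp add: \<beta>)
  \<comment> \<open>The coefficient of \<open>\<beta>3\<close> is collected by the Zinbiel identity;
    those of \<open>\<beta>2\<close> and \<open>\<beta>1\<close> are rearranged by
    \<open>left_comm\<close>.\<close>
  also have "\<dots> = ?t (zm a1 (zm a2 a3)) \<beta>3 + ?t (zm a1 (zm a3 a2)) \<beta>2 + ?t (zm a2 (zm a3 a1)) \<beta>1"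
    using tens_add[of "zm (zm a1 a2) a3" "zm (zm a2 a1) a3" \<beta>3] a b
      left_comm[of a3 a1 a2] left_comm[of a3 a2 a1]
    by (simp add: A.zinbiel[of a1 a2 a3] zm_mem pm_mem \<beta>(3) add_ac)
  also have "\<dots> = ?t (zm a1 (zm a2 a3)) \<beta>3 + ?t (zm (zm a2 a3) a1) \<beta>1 +
      (?t (zm a1 (zm a3 a2)) \<beta>2 + ?t (zm (zm a3 a2) a1) \<beta>1)"
    using tens_add[of "zm (zm a2 a3) a1" "zm (zm a3 a2) a1" \<beta>1] a b
    by (simp add: A.zinbiel[of a2 a3 a1] zm_mem pm_mem \<beta>(1) add_ac)
  also have "\<dots> = mult (?t a1 b1) (mult (?t a2 b2) (?t a3 b3))"
    using a b linear_map_add[OF mult_right, of "?t a1 b1" "?t (zm a2 a3) (pm b2 b3)" "?t (zm a3 a2) (pm b3 b2)"]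
    by (simp add: mult_tens tens_in_tensor_space zm_mem pm_mem \<beta>1 \<beta>2) (simp add: \<beta>)
  finally show ?thesis .
qed

lemma mult_assoc:
  assumes "s \<in> carr C" "t \<in> carr C" "u \<in> carr C"
  shows "mult (mult s t) u = mult s (mult t u)"
  using assms(1)
\<comment> \<open>The three arguments are reduced to pure tensors one after another, since both
  sides are linear in each.\<close>
proof (rule linear_map_tensor_eqI[OF linear_map_compose[OF mult_left mult_left] mult_left, rotated 4])
  fix a1 b1 assume 1: "a1 \<in> carr A" "b1 \<in> carr B"
  then have x: "tens A B a1 b1 \<in> carr C" by (rule tens_in_tensor_space)
  show "mult (mult (tens A B a1 b1) t) u = mult (tens A B a1 b1) (mult t u)"
    using assms(2)
  proof (rule linear_map_tensor_eqI[OF linear_map_compose[OF mult_right mult_left]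
        linear_map_compose[OF mult_left mult_right], rotated 5])
    fix a2 b2 assume 2: "a2 \<in> carr A" "b2 \<in> carr B"
    then have y: "tens A B a2 b2 \<in> carr C" by (rule tens_in_tensor_space)
    show "mult (mult (tens A B a1 b1) (tens A B a2 b2)) u =
        mult (tens A B a1 b1) (mult (tens A B a2 b2) u)"
      using assms(3)
      by (rule linear_map_tensor_eqI[OF mult_right linear_map_compose[OF mult_right mult_right],
            rotated 4]) (use 1 2 x y mult_mem mult_assoc_tens in auto)
  qed (use x assms mult_mem in auto)
qed (use assms mult_mem in auto)

sublocale comm_assoc_algebra C mult
  by (intro comm_assoc_algebra.intro comm_assoc_algebra_axioms.intro vector_space_on_tensor
      bilinear_map_mult mult_assoc mult_comm)

end

section \<open>The representation on the dual space\<close>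

lemma (in comm_assoc_algebra) dual_representation:
  "comm_assoc_representation C m (dual C) (neg_u_dual C m)"
proof -
  note mem = bilinear_map_mem[OF bilinear]
  have closed: "neg_u_dual C m c \<xi> \<in> carr (dual C)" if "c \<in> carr C" "\<xi> \<in> carr (dual C)" for c \<xi>
    unfolding neg_u_dual_def
    by (rule restrict_in_dual[OF vector_space_on_axioms linear_map_compose[OF _ dual_linear]])
      (use that bilinear_map_right[OF bilinear] in auto)
  show ?thesis
  proof (intro comm_assoc_representation.intro comm_assoc_algebra_axioms vector_space_on_dual
      comm_assoc_representation_axioms.intro bilinear_mapI)
    show "linear_map (dual C) (dual C) (neg_u_dual C m c)" if "c \<in> carr C" for c
      by (rule linear_mapI) (use that closed in \<open>auto simp: neg_u_dual_def fscale_def fun_eq_iff\<close>)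
    show "linear_map C (dual C) (\<lambda>c. neg_u_dual C m c \<xi>)" if \<xi>: "\<xi> \<in> carr (dual C)" for \<xi>
    proof (rule linear_mapI)
      show "neg_u_dual C m (c + d) \<xi> = neg_u_dual C m c \<xi> + neg_u_dual C m d \<xi>"
        if "c \<in> carr C" "d \<in> carr C" for c d
        using that linear_map_add[OF dual_linear[OF \<xi>]]
        by (auto simp: neg_u_dual_def fun_eq_iff mem linear_map_add[OF bilinear_map_left[OF bilinear]])
      show "neg_u_dual C m (scl C a c) \<xi> = scl (dual C) a (neg_u_dual C m c \<xi>)"
        if "c \<in> carr C" for a c
        using that linear_map_scale[OF dual_linear[OF \<xi>]]
        by (auto simp: neg_u_dual_def fscale_def fun_eq_iff mem
            linear_map_scale[OF bilinear_map_left[OF bilinear]])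
    qed (use \<xi> closed in auto)
    \<comment> \<open>Transposition reverses the order: at \<open>c'\<close> the left side is
      \<open>\<xi> (m d (m c c'))\<close>. Commutativity of the algebra restores the order.\<close>
    show "neg_u_dual C m c (neg_u_dual C m d \<xi>) = neg_u_dual C m (m c d) \<xi>"
      if "c \<in> carr C" "d \<in> carr C" "\<xi> \<in> carr (dual C)" for c d \<xi>
      using that by (auto simp: neg_u_dual_def fun_eq_iff mem comm[of c d] assoc)
  qed
qed

section \<open>Trilinear forms\<close>

lemma restrict_in_bilinear_forms:
  assumes "vector_space_on V" "vector_space_on W" "bilinear_map V W scalars h"
  shows "(\<lambda>v w. if v \<in> carr V \<and> w \<in> carr W then h v w else 0) \<in> bilinear_forms V W"
proof -
  have "linear_map W scalars (\<lambda>w. if v \<in> carr V \<and> w \<in> carr W then h v w else 0)"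
    if "v \<in> carr V" for v
    by (rule linear_map_cong[OF assms(2) bilinear_map_right[OF assms(3) that]]) (simp add: that)
  moreover have "linear_map V scalars (\<lambda>v. if v \<in> carr V \<and> w \<in> carr W then h v w else 0)"
    if "w \<in> carr W" for w
    by (rule linear_map_cong[OF assms(1) bilinear_map_left[OF assms(3) that]]) (simp add: that)
  ultimately show ?thesis by (auto simp: bilinear_forms_def intro!: bilinear_mapI)
qed

text \<open>Symmetry of r enters the argument in this form: inside a bilinear expression the two
  legs may be exchanged. It follows by evaluating the flip identity at \<open>h\<close>.\<close>

lemma symmetric_tensor_swap:
  assumes "vector_space_on V" and "\<And>i. i \<in> I \<Longrightarrow> x i \<in> carr V" "\<And>i. i \<in> I \<Longrightarrow> y i \<in> carr V"
    and sym: "tensor_flip V V (\<Sum>i\<in>I. tens V V (x i) (y i)) = (\<Sum>i\<in>I. tens V V (x i) (y i))"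
    and h: "bilinear_map V V scalars h"
  shows "(\<Sum>i\<in>I. h (x i) (y i)) = (\<Sum>i\<in>I. h (y i) (x i))"
proof -
  interpret T: vector_space_on "V \<otimes>\<^sub>V V" by (rule vector_space_on_tensor)
  \<comment> \<open>The cut-off matters: \<open>tens\<close> returns 0 at any function outside
    \<open>bilinear_forms\<close>.\<close>
  define \<beta> where "\<beta> v w = (if v \<in> carr V \<and> w \<in> carr V then h v w else 0)" for v w
  have \<beta>: "\<beta> \<in> bilinear_forms V V"
    using restrict_in_bilinear_forms[OF assms(1,1) h] unfolding \<beta>_def .
  have flip: "linear_map (V \<otimes>\<^sub>V V) (V \<otimes>\<^sub>V V) (tensor_flip V V)"
    unfolding tensor_flip_def
    by (rule linear_map_tensor_lift[OF assms(1,1) vector_space_on_tensor bilinear_map_swap[OF bilinear_map_tens]])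
      simp
  have "tensor_flip V V (\<Sum>i\<in>I. tens V V (x i) (y i)) = (\<Sum>i\<in>I. tens V V (y i) (x i))"
    using assms(1-3) by (subst T.linear_map_sum[OF flip]) (auto simp: tens_in_tensor_space tensor_flip_tens)
  then have "(\<Sum>i\<in>I. tens V V (x i) (y i)) \<beta> = (\<Sum>i\<in>I. tens V V (y i) (x i)) \<beta>"
    using sym by simp
  then show ?thesis
    using assms(2,3) by (simp add: sum_fun_apply tens_def \<beta>) (simp add: \<beta>_def)
qed

definition trilinear_form ::
  "('k::field, 'v::ab_group_add) vec_space \<Rightarrow> ('v \<Rightarrow> 'v \<Rightarrow> 'v \<Rightarrow> 'k) \<Rightarrow> bool" where
  "trilinear_form V h \<longleftrightarrow> (\<forall>a\<in>carr V. \<forall>b\<in>carr V. linear_map V scalars (\<lambda>c. h c a b) \<and>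
     linear_map V scalars (\<lambda>c. h a c b) \<and> linear_map V scalars (\<lambda>c. h a b c))"

lemma
  assumes "trilinear_form V h" "a \<in> carr V" "b \<in> carr V"
  shows trilinear_form_1: "linear_map V scalars (\<lambda>c. h c a b)"
    and trilinear_form_2: "linear_map V scalars (\<lambda>c. h a c b)"
    and trilinear_form_3: "linear_map V scalars (\<lambda>c. h a b c)"
  using assms by (auto simp: trilinear_form_def)

lemma trilinear_form_mult:
  assumes "linear_map V scalars \<phi>" "linear_map V scalars \<psi>" "linear_map V scalars \<chi>"
  shows "trilinear_form V (\<lambda>a b c. \<phi> a * \<psi> b * \<chi> c)"
  unfolding trilinear_form_def
  using assms by (auto intro!: linear_map_mult_left linear_map_mult_right)

lemma trilinear_form_swap23: "trilinear_form V h \<Longrightarrow> trilinear_form V (\<lambda>a b c. h a c b)"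
  by (auto simp: trilinear_form_def)

text \<open>Triple tensors are nested, so a trilinear form must be repackaged as a bilinear form on
  \<open>V\<close> and \<open>V \<otimes>\<^sub>V V\<close> before \<open>Z\<^sub>r\<close> can be
  evaluated at it.\<close>

lemma trilinear_form_tens:
  assumes "vector_space_on V" "trilinear_form V h"
  obtains \<beta> where "\<And>a b c. a \<in> carr V \<Longrightarrow> b \<in> carr V \<Longrightarrow> c \<in> carr V \<Longrightarrow>
    tens V (V \<otimes>\<^sub>V V) a (tens V V b c) \<beta> = h a b c"
proof
  let ?T = "V \<otimes>\<^sub>V V"
  define \<gamma> where "\<gamma> a b c = (if b \<in> carr V \<and> c \<in> carr V then h a b c else 0)" for a b c
  \<comment> \<open>A tensor acts on forms by application, so \<open>t (\<gamma> a)\<close> is the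
    linear extension of the slice \<open>\<gamma> a\<close>. Linearity in \<open>a\<close> is
    additivity and homogeneity of tensors on forms.\<close>
  define \<beta> where "\<beta> a t = (if a \<in> carr V \<and> t \<in> carr ?T then t (\<gamma> a) else 0)" for a t
  have \<gamma>: "\<gamma> a \<in> bilinear_forms V V" if "a \<in> carr V" for a
    unfolding \<gamma>_def using trilinear_form_2[OF assms(2) that] trilinear_form_3[OF assms(2) that]
    by (intro restrict_in_bilinear_forms assms(1) bilinear_mapI)
  have "bilinear_map V ?T scalars (\<lambda>a t. t (\<gamma> a))"
  proof (rule bilinear_mapI)
    show "linear_map ?T scalars (\<lambda>t. t (\<gamma> a))" for a
      by (simp add: linear_map_def fscale_def)
    fix t assume t: "t \<in> carr ?T"
    show "linear_map V scalars (\<lambda>a. t (\<gamma> a))"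
    proof (rule linear_mapI)
      show "t (\<gamma> (a + b)) = t (\<gamma> a) + t (\<gamma> b)" if ab: "a \<in> carr V" "b \<in> carr V" for a b
      proof -
        have "\<gamma> (a + b) = (\<lambda>v w. \<gamma> a v w + \<gamma> b v w)"
          using linear_map_add[OF trilinear_form_1[OF assms(2)] ab] by (auto simp: \<gamma>_def fun_eq_iff)
        then show ?thesis using tensor_apply_add[OF t \<gamma> \<gamma>] ab by simp
      qed
      show "t (\<gamma> (scl V c a)) = scl scalars c (t (\<gamma> a))" if a: "a \<in> carr V" for a c
      proof -
        have "\<gamma> (scl V c a) = (\<lambda>v w. c * \<gamma> a v w)"
          using linear_map_scale[OF trilinear_form_1[OF assms(2)] a] by (auto simp: \<gamma>_def fun_eq_iff)
        then show ?thesis using tensor_apply_scale[OF t \<gamma>] a by simp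
      qed
    qed simp
  qed
  from restrict_in_bilinear_forms[OF assms(1) vector_space_on_tensor this]
  have \<beta>: "\<beta> \<in> bilinear_forms V ?T" unfolding \<beta>_def .
  show "tens V ?T a (tens V V b c) \<beta> = h a b c" if "a \<in> carr V" "b \<in> carr V" "c \<in> carr V" for a b c
  proof -
    have "tens V ?T a (tens V V b c) \<beta> = tens V V b c (\<gamma> a)"
      using that \<beta> unfolding tens_def[of V ?T] by (simp add: \<beta>_def tens_in_tensor_space)
    also have "\<dots> = h a b c" using that \<gamma> by (simp add: tens_def) (simp add: \<gamma>_def)
    finally show ?thesis .
  qed
qed

text \<open>Evaluate \<open>Z\<^sub>r\<close> at \<open>h\<close> with its last two slots exchanged,
  then exchange \<open>x j\<close> and \<open>y j\<close> in each of the four terms. The fourth term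
  becomes the left side.\<close>

lemma (in zinbiel_algebra) zinbiel_YB_form:
  assumes x: "\<And>i. i < N \<Longrightarrow> x i \<in> carr A" and y: "\<And>i. i < N \<Longrightarrow> y i \<in> carr A"
    and sym: "tensor_flip A A (\<Sum>i<N. tens A A (x i) (y i)) = (\<Sum>i<N. tens A A (x i) (y i))"
    and YB: "zinbiel_YB A zm N x y = 0"
    and h: "trilinear_form A h"
  shows "(\<Sum>i<N. \<Sum>j<N. h (x i) (x j) (zm (y i) (y j))) =
    (\<Sum>i<N. \<Sum>j<N. h (x i) (zm (y i) (x j)) (y j) + h (x i) (zm (x j) (y i)) (y j)
      - h (zm (x j) (y i)) (x i) (y j))"
proof -
  note mem = bilinear_map_mem[OF bilinear]
  note zl = linear_map_compose[OF bilinear_map_left[OF bilinear]]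
    and zr = linear_map_compose[OF bilinear_map_right[OF bilinear]]
  note swap = symmetric_tensor_swap[OF vector_space_on_axioms, of "{..<N}" x y, OF _ _ sym]
  obtain \<beta> where \<beta>: "\<And>a b c. a \<in> carr A \<Longrightarrow> b \<in> carr A \<Longrightarrow> c \<in> carr A \<Longrightarrow>
      tens A (A \<otimes>\<^sub>V A) a (tens A A b c) \<beta> = h a c b"
    using trilinear_form_tens[OF vector_space_on_axioms trilinear_form_swap23[OF h]] by metis
  have "0 = zinbiel_YB A zm N x y \<beta>" by (simp add: YB)
  also have "\<dots> = (\<Sum>i<N. \<Sum>j<N. h (x i) (zm (y i) (y j)) (x j) + h (x i) (zm (y j) (y i)) (x j)
      - h (zm (x i) (x j)) (y j) (y i) - h (x i) (y j) (zm (y i) (x j)))"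
    by (simp add: zinbiel_YB_def Let_def sum_fun_apply \<beta> x y mem)
  \<comment> \<open>The third sum is written with \<open>j\<close> outermost, so that after its swap
    it agrees with the third term of the claim up to renaming both indices.\<close>
  also have "\<dots> = (\<Sum>i<N. \<Sum>j<N. h (x i) (zm (y i) (y j)) (x j)) +
      (\<Sum>i<N. \<Sum>j<N. h (x i) (zm (y j) (y i)) (x j)) -
      (\<Sum>j<N. \<Sum>i<N. h (zm (x i) (x j)) (y j) (y i)) - (\<Sum>i<N. \<Sum>j<N. h (x i) (y j) (zm (y i) (x j)))"
    by (simp add: sum.distrib sum_subtractf sum.swap[of "\<lambda>i j. h (zm (x i) (x j)) (y j) (y i)"])
  also have "(\<Sum>i<N. \<Sum>j<N. h (x i) (zm (y i) (y j)) (x j)) = (\<Sum>i<N. \<Sum>j<N. h (x i) (zm (y i) (x j)) (y j))"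
    by (intro sum.cong refl swap[symmetric] bilinear_mapI)
      (auto intro!: trilinear_form_3[OF h] zr[OF _ trilinear_form_2[OF h]] x y mem)
  also have "(\<Sum>i<N. \<Sum>j<N. h (x i) (zm (y j) (y i)) (x j)) = (\<Sum>i<N. \<Sum>j<N. h (x i) (zm (x j) (y i)) (y j))"
    by (intro sum.cong refl swap[symmetric] bilinear_mapI)
      (auto intro!: trilinear_form_3[OF h] zl[OF _ trilinear_form_2[OF h]] x y mem)
  also have "(\<Sum>j<N. \<Sum>i<N. h (zm (x i) (x j)) (y j) (y i)) = (\<Sum>j<N. \<Sum>i<N. h (zm (x i) (y j)) (x j) (y i))"
    (is "?l = ?r")
  proof -
    have "?l = (\<Sum>i<N. \<Sum>j<N. h (zm (x i) (x j)) (y j) (y i))" by (rule sum.swap)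
    also have "\<dots> = (\<Sum>i<N. \<Sum>j<N. h (zm (x i) (y j)) (x j) (y i))"
      by (intro sum.cong refl swap bilinear_mapI)
        (auto intro!: trilinear_form_2[OF h] zr[OF _ trilinear_form_1[OF h]] x y mem)
    finally show ?thesis by (subst sum.swap)
  qed
  also have "(\<Sum>i<N. \<Sum>j<N. h (x i) (y j) (zm (y i) (x j))) = (\<Sum>i<N. \<Sum>j<N. h (x i) (x j) (zm (y i) (y j)))"
    by (intro sum.cong refl swap[symmetric] bilinear_mapI)
      (auto intro!: trilinear_form_2[OF h] zr[OF _ trilinear_form_3[OF h]] x y mem)
  finally show ?thesis by (simp add: sum.distrib sum_subtractf algebra_simps)
qed

section \<open>Dual bases of a quadratic perm algebra\<close>

lemma linear_map_form_expand:
  assumes "vector_space_on V" "linear_map V scalars \<phi>" "\<And>i. i < n \<Longrightarrow> u i \<in> carr V"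
    and "v = (\<Sum>i<n. scl V (c i) (u i))"
  shows "\<phi> v = (\<Sum>i<n. c i * \<phi> (u i))"
  using vector_space_on.linear_map_sum_scale[OF assms(1,2), of "{..<n}" u c] assms(3,4) by simp

locale quadratic_perm_dual_bases = quadratic_perm_algebra B pm \<omega>
  for B :: "('k::field, 'b::ab_group_add) vec_space" and pm \<omega> +
  fixes n :: nat and e f :: "nat \<Rightarrow> 'b"
  assumes basis_e: "is_basis B n e" and basis_f: "is_basis B n f"
    and dual_bases: "\<And>i j. i < n \<Longrightarrow> j < n \<Longrightarrow> \<omega> (f i) (e j) = (if i = j then 1 else 0)"
begin

lemma e_mem: "i < n \<Longrightarrow> e i \<in> carr B" and f_mem: "i < n \<Longrightarrow> f i \<in> carr B"
proof -
  interpret v: vector_space "scl B" by (rule ambient)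
  show "i < n \<Longrightarrow> e i \<in> carr B" "i < n \<Longrightarrow> f i \<in> carr B"
    using basis_e basis_f v.span_base by (auto simp: is_basis_def)
qed

lemmas pm_mem = bilinear_map_mem[OF bilinear]

text \<open>Biorthogonality makes the values of the form the coordinates: pairing with
  \<open>f k\<close> on the left gives those in the basis \<open>e\<close>, pairing with
  \<open>e k\<close> on the right those in \<open>f\<close>.\<close>

lemma expand_e: "b \<in> carr B \<Longrightarrow> b = (\<Sum>k<n. scl B (\<omega> (f k) b) (e k))"
  using basis_e dual_bases
  by (intro spanning_expansion) (auto simp: is_basis_def f_mem intro: bilinear_map_right[OF form_bilinear])

lemma expand_f: "b \<in> carr B \<Longrightarrow> b = (\<Sum>k<n. scl B (\<omega> b (e k)) (f k))"
  using basis_f dual_bases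
  by (intro spanning_expansion) (auto simp: is_basis_def e_mem intro: bilinear_map_left[OF form_bilinear])

text \<open>Invariance is applied between two uses of antisymmetry. The outcome is that right
  multiplication by \<open>a\<close> has adjoint \<open>b \<mapsto> pm a b - pm b a\<close>.\<close>

lemma form_mult_right:
  assumes "a \<in> carr B" "b \<in> carr B" "c \<in> carr B"
  shows "\<omega> b (pm c a) = \<omega> (pm a b - pm b a) c"
proof -
  have "\<omega> b (pm c a) = - \<omega> c (pm a b - pm b a)"
    using form_antisym[of b "pm c a"] form_invariant[of c a b] assms by (simp add: pm_mem)
  then show ?thesis
    using form_antisym[of c "pm a b - pm b a"] assms by (simp add: pm_mem diff_closed)
qed

text \<open>Left multiplication by \<open>a\<close> is self-adjoint: in the invariance identity the
  term with right multiplication is replaced by \<open>form_mult_right\<close>, and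
  \<open>\<omega> (pm b a) c\<close> cancels.\<close>

lemma form_mult_left:
  assumes "a \<in> carr B" "b \<in> carr B" "c \<in> carr B"
  shows "\<omega> b (pm a c) = \<omega> (pm a b) c"
proof -
  have "\<omega> (pm b a) c = \<omega> b (pm a c) - \<omega> b (pm c a)"
    using form_invariant[of b a c] assms linear_map_diff[OF bilinear_map_right[OF form_bilinear]]
    by (simp add: pm_mem)
  moreover have "\<omega> (pm a b - pm b a) c = \<omega> (pm a b) c - \<omega> (pm b a) c"
    using assms linear_map_diff[OF bilinear_map_left[OF form_bilinear]] by (simp add: pm_mem)
  ultimately show ?thesis using form_mult_right[OF assms] by simp
qed

text \<open>An operator on the first leg of \<open>\<kappa>\<close> may be replaced by its adjoint
  on the second leg. Here \<open>u j l\<close> is the operator at \<open>e l\<close> and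
  \<open>v j k\<close> its adjoint at \<open>f k\<close>: expand in \<open>e\<close>, exchange the
  sums, and recollect in \<open>f\<close>.\<close>

lemma sum_transfer:
  assumes h: "trilinear_form B h"
    and u: "\<And>j l. j < n \<Longrightarrow> l < n \<Longrightarrow> u j l \<in> carr B" and v: "\<And>j l. j < n \<Longrightarrow> l < n \<Longrightarrow> v j l \<in> carr B"
    and adj: "\<And>j k l. j < n \<Longrightarrow> k < n \<Longrightarrow> l < n \<Longrightarrow> \<omega> (f k) (u j l) = \<omega> (v j k) (e l)"
  shows "(\<Sum>j<n. \<Sum>l<n. h (e j) (u j l) (f l)) = (\<Sum>j<n. \<Sum>l<n. h (e j) (e l) (v j l))"
proof (rule sum.cong[OF refl])
  fix j assume j: "j \<in> {..<n}"
  have "(\<Sum>l<n. h (e j) (u j l) (f l)) = (\<Sum>l<n. \<Sum>k<n. \<omega> (f k) (u j l) * h (e j) (e k) (f l))"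
    using j by (intro sum.cong refl linear_map_form_expand[OF vector_space_on_axioms trilinear_form_2[OF h]] expand_e)
      (auto simp: u e_mem f_mem)
  also have "\<dots> = (\<Sum>k<n. \<Sum>l<n. \<omega> (v j k) (e l) * h (e j) (e k) (f l))"
    using j by (subst sum.swap) (simp add: adj)
  also have "\<dots> = (\<Sum>k<n. h (e j) (e k) (v j k))"
    using j
    by (intro sum.cong refl linear_map_form_expand[OF vector_space_on_axioms trilinear_form_3[OF h], symmetric] expand_f)
      (auto simp: v e_mem f_mem)
  finally show "(\<Sum>l<n. h (e j) (u j l) (f l)) = (\<Sum>l<n. h (e j) (e l) (v j l))" .
qed

lemma sum_mult_left:
  assumes "trilinear_form B h"
  shows "(\<Sum>j<n. \<Sum>l<n. h (e j) (pm (f j) (e l)) (f l)) = (\<Sum>j<n. \<Sum>l<n. h (e j) (e l) (pm (f j) (f l)))"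
  by (rule sum_transfer[OF assms]) (simp_all add: pm_mem e_mem f_mem form_mult_left)

text \<open>Here the adjoint is a commutator with \<open>f j\<close>. Its second term, with
  \<open>f l\<close> and \<open>f j\<close> reversed, is the source of \<open>R\<close>.\<close>

lemma sum_mult_right:
  assumes h: "trilinear_form B h"
  shows "(\<Sum>j<n. \<Sum>l<n. h (e j) (pm (e l) (f j)) (f l)) =
    (\<Sum>j<n. \<Sum>l<n. h (e j) (e l) (pm (f j) (f l)) - h (e j) (e l) (pm (f l) (f j)))"
proof -
  have "(\<Sum>j<n. \<Sum>l<n. h (e j) (pm (e l) (f j)) (f l)) =
      (\<Sum>j<n. \<Sum>l<n. h (e j) (e l) (pm (f j) (f l) - pm (f l) (f j)))"
    by (rule sum_transfer[OF h]) (simp_all add: pm_mem e_mem f_mem diff_closed form_mult_right)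
  then show ?thesis
    by (simp add: linear_map_diff[OF trilinear_form_3[OF h]] e_mem f_mem pm_mem)
qed

end

section \<open>The O-operator\<close>

lemma sum_swap_pairs:
  "(\<Sum>i\<in>I. \<Sum>k\<in>K. \<Sum>j\<in>J. \<Sum>l\<in>L. F i k j l) = (\<Sum>j\<in>J. \<Sum>l\<in>L. \<Sum>i\<in>I. \<Sum>k\<in>K. F i k j l)"
proof -
  have "(\<Sum>i\<in>I. \<Sum>k\<in>K. \<Sum>j\<in>J. \<Sum>l\<in>L. F i k j l) = (\<Sum>i\<in>I. \<Sum>j\<in>J. \<Sum>k\<in>K. \<Sum>l\<in>L. F i k j l)"
    by (intro sum.cong refl sum.swap)
  also have "\<dots> = (\<Sum>j\<in>J. \<Sum>i\<in>I. \<Sum>k\<in>K. \<Sum>l\<in>L. F i k j l)"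
    by (rule sum.swap)
  also have "\<dots> = (\<Sum>j\<in>J. \<Sum>i\<in>I. \<Sum>l\<in>L. \<Sum>k\<in>K. F i k j l)"
    by (intro sum.cong refl sum.swap)
  also have "\<dots> = (\<Sum>j\<in>J. \<Sum>l\<in>L. \<Sum>i\<in>I. \<Sum>k\<in>K. F i k j l)"
    by (intro sum.cong refl sum.swap)
  finally show ?thesis .
qed

locale zinbiel_YB_perm = A: zinbiel_algebra A zm + B: quadratic_perm_dual_bases B pm \<omega> n e f
  for A :: "('k::field, 'a::ab_group_add) vec_space" and zm
    and B :: "('k, 'b::ab_group_add) vec_space" and pm \<omega> n e f +
  fixes N :: nat and x y :: "nat \<Rightarrow> 'a"
  assumes x_mem: "\<And>i. i < N \<Longrightarrow> x i \<in> carr A" and y_mem: "\<And>i. i < N \<Longrightarrow> y i \<in> carr A"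
    and r_sym: "tensor_flip A A (\<Sum>i<N. tens A A (x i) (y i)) = (\<Sum>i<N. tens A A (x i) (y i))"
    and YB: "zinbiel_YB A zm N x y = 0"
begin

sublocale zinbiel_perm A zm B pm ..

abbreviation t where "t \<equiv> tens A B"

definition r_hat :: "('k, ('k, 'a, 'b) tensor, ('k, 'a, 'b) tensor) tensor" where
  "r_hat = (\<Sum>i<N. \<Sum>j<n. tens C C (t (x i) (e j)) (t (y i) (f j)))"

lemmas mem = x_mem y_mem B.e_mem B.f_mem zm_mem pm_mem tens_in_tensor_space

text \<open>The facts about \<open>sharp\<close> concern single sums, so the double sum is indexed
  by pairs.\<close>

lemma r_hat_pairs:
  "r_hat = (\<Sum>p\<in>{..<N} \<times> {..<n}. tens C C (t (x (fst p)) (e (snd p))) (t (y (fst p)) (f (snd p))))"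
  unfolding r_hat_def sum.cartesian_product by (simp add: split_beta)

lemma linear_map_sharp_r_hat: "linear_map (dual C) C (sharp C r_hat)"
  unfolding r_hat_pairs
  by (rule linear_map_sharp[OF vector_space_on_tensor separated_tensor]) (auto intro!: mem)

lemma sharp_r_hat:
  assumes "\<xi> \<in> carr (dual C)"
  shows "sharp C r_hat \<xi> = (\<Sum>i<N. \<Sum>j<n. scl C (\<xi> (t (x i) (e j))) (t (y i) (f j)))"
  unfolding r_hat_pairs sum.cartesian_product
  by (subst sharp_sum[OF vector_space_on_tensor separated_tensor assms]) (auto intro!: mem sum.cong)

lemma form_sharp_r_hat:
  assumes "\<xi> \<in> carr (dual C)" "linear_map C scalars \<phi>"
  shows "\<phi> (sharp C r_hat \<xi>) = (\<Sum>i<N. \<Sum>j<n. \<xi> (t (x i) (e j)) * \<phi> (t (y i) (f j)))"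
  unfolding sharp_r_hat[OF assms(1)] sum.cartesian_product split_beta
  by (subst linear_map_sum_scale[OF assms(2)]) (auto intro!: mem)

section \<open>Pairing both sides of the identity with a functional\<close>

lemma tens_left:
  assumes "b \<in> carr B" "\<xi> \<in> carr (dual C)"
  shows "linear_map A scalars (\<lambda>a. \<xi> (t a b))"
  by (rule linear_map_compose[OF bilinear_map_left[OF bilinear_map_tens assms(1)] dual_linear[OF assms(2)]])

lemma tens_right:
  assumes "a \<in> carr A" "\<xi> \<in> carr (dual C)"
  shows "linear_map B scalars (\<lambda>b. \<xi> (t a b))"
  by (rule linear_map_compose[OF bilinear_map_right[OF bilinear_map_tens assms(1)] dual_linear[OF assms(2)]])

context
  fixes \<zeta> assumes \<zeta>: "\<zeta> \<in> carr (dual C)"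
begin

definition L where "L \<xi> \<eta> = (\<Sum>i<N. \<Sum>k<N. \<Sum>j<n. \<Sum>l<n.
  \<xi> (t (x i) (e j)) * \<eta> (t (x k) (e l)) * \<zeta> (t (zm (y i) (y k)) (pm (f j) (f l))))"

definition P where "P \<xi> \<eta> = (\<Sum>i<N. \<Sum>k<N. \<Sum>j<n. \<Sum>l<n.
  \<xi> (t (x i) (e j)) * (\<eta> (t (zm (y i) (x k)) (e l)) + \<eta> (t (zm (x k) (y i)) (e l))) *
    \<zeta> (t (y k) (pm (f j) (f l))))"

definition R where "R \<xi> \<eta> = (\<Sum>i<N. \<Sum>k<N. \<Sum>j<n. \<Sum>l<n.
  \<xi> (t (zm (x k) (y i)) (e j)) * \<eta> (t (x i) (e l)) * \<zeta> (t (y k) (pm (f j) (f l))))"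

text \<open>For fixed \<open>j\<close> and \<open>l\<close> the components in \<open>B\<close> are
  constants, and the three functionals restrict to a trilinear form on \<open>A\<close>. The
  Yang-Baxter equation is applied to each of these forms and the results are added.\<close>

lemma L_eq_P_minus_R:
  assumes \<xi>: "\<xi> \<in> carr (dual C)" and \<eta>: "\<eta> \<in> carr (dual C)"
  shows "L \<xi> \<eta> = P \<xi> \<eta> - R \<xi> \<eta>"
proof -
  have "L \<xi> \<eta> = (\<Sum>j<n. \<Sum>l<n. \<Sum>i<N. \<Sum>k<N.
      \<xi> (t (x i) (e j)) * \<eta> (t (x k) (e l)) * \<zeta> (t (zm (y i) (y k)) (pm (f j) (f l))))"
    unfolding L_def by (rule sum_swap_pairs)
  also have "\<dots> = (\<Sum>j<n. \<Sum>l<n. \<Sum>i<N. \<Sum>k<N.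
      \<xi> (t (x i) (e j)) * \<eta> (t (zm (y i) (x k)) (e l)) * \<zeta> (t (y k) (pm (f j) (f l))) +
      \<xi> (t (x i) (e j)) * \<eta> (t (zm (x k) (y i)) (e l)) * \<zeta> (t (y k) (pm (f j) (f l))) -
      \<xi> (t (zm (x k) (y i)) (e j)) * \<eta> (t (x i) (e l)) * \<zeta> (t (y k) (pm (f j) (f l))))"
  proof (rule sum.cong[OF refl], rule sum.cong[OF refl])
    fix j l assume "j \<in> {..<n}" "l \<in> {..<n}"
    then have "trilinear_form A (\<lambda>a b c. \<xi> (t a (e j)) * \<eta> (t b (e l)) * \<zeta> (t c (pm (f j) (f l))))"
      using \<xi> \<eta> \<zeta> by (intro trilinear_form_mult tens_left) (auto intro!: mem)
    from A.zinbiel_YB_form[OF x_mem y_mem r_sym YB this]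
    show "(\<Sum>i<N. \<Sum>k<N. \<xi> (t (x i) (e j)) * \<eta> (t (x k) (e l)) * \<zeta> (t (zm (y i) (y k)) (pm (f j) (f l)))) =
      (\<Sum>i<N. \<Sum>k<N.
      \<xi> (t (x i) (e j)) * \<eta> (t (zm (y i) (x k)) (e l)) * \<zeta> (t (y k) (pm (f j) (f l))) +
      \<xi> (t (x i) (e j)) * \<eta> (t (zm (x k) (y i)) (e l)) * \<zeta> (t (y k) (pm (f j) (f l))) -
      \<xi> (t (zm (x k) (y i)) (e j)) * \<eta> (t (x i) (e l)) * \<zeta> (t (y k) (pm (f j) (f l))))" .
  qed
  also have "\<dots> = P \<xi> \<eta> - R \<xi> \<eta>"
    unfolding P_def R_def sum_subtractf[symmetric]
    by (subst sum_swap_pairs) (simp add: algebra_simps)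
  finally show ?thesis .
qed

lemma form_mult_sharp:
  assumes \<xi>: "\<xi> \<in> carr (dual C)" and \<eta>: "\<eta> \<in> carr (dual C)"
  shows "\<zeta> (mult (sharp C r_hat \<xi>) (sharp C r_hat \<eta>)) = L \<xi> \<eta> + L \<eta> \<xi>"
proof -
  have T: "sharp C r_hat \<eta> \<in> carr C" by (rule linear_map_mem[OF linear_map_sharp_r_hat \<eta>])
  have "\<zeta> (mult (sharp C r_hat \<xi>) (sharp C r_hat \<eta>)) = (\<Sum>i<N. \<Sum>j<n. \<xi> (t (x i) (e j)) *
      (\<Sum>k<N. \<Sum>l<n. \<eta> (t (x k) (e l)) * \<zeta> (mult (t (y i) (f j)) (t (y k) (f l)))))"
    by (subst form_sharp_r_hat[OF \<xi> linear_map_compose[OF mult_left[OF T] dual_linear[OF \<zeta>]]],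
        intro sum.cong refl arg_cong[of _ _ "\<lambda>z. _ * z"]
          form_sharp_r_hat[OF \<eta> linear_map_compose[OF mult_right dual_linear[OF \<zeta>]]])
      (auto intro!: mem)
  also have "\<dots> = (\<Sum>i<N. \<Sum>j<n. \<Sum>k<N. \<Sum>l<n.
      \<xi> (t (x i) (e j)) * \<eta> (t (x k) (e l)) * \<zeta> (t (zm (y i) (y k)) (pm (f j) (f l))) +
      \<eta> (t (x k) (e l)) * \<xi> (t (x i) (e j)) * \<zeta> (t (zm (y k) (y i)) (pm (f l) (f j))))"
    unfolding sum_distrib_left
    by (intro sum.cong refl)
      (simp add: mult_tens mem linear_map_add[OF dual_linear[OF \<zeta>]] algebra_simps)
  also have "\<dots> = (\<Sum>i<N. \<Sum>j<n. \<Sum>k<N. \<Sum>l<n.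
      \<xi> (t (x i) (e j)) * \<eta> (t (x k) (e l)) * \<zeta> (t (zm (y i) (y k)) (pm (f j) (f l)))) +
      (\<Sum>i<N. \<Sum>j<n. \<Sum>k<N. \<Sum>l<n.
      \<eta> (t (x k) (e l)) * \<xi> (t (x i) (e j)) * \<zeta> (t (zm (y k) (y i)) (pm (f l) (f j))))"
    by (simp only: sum.distrib)
  also have "(\<Sum>i<N. \<Sum>j<n. \<Sum>k<N. \<Sum>l<n.
      \<xi> (t (x i) (e j)) * \<eta> (t (x k) (e l)) * \<zeta> (t (zm (y i) (y k)) (pm (f j) (f l)))) = L \<xi> \<eta>"
    unfolding L_def by (intro sum.cong refl sum.swap)
  \<comment> \<open>The second summand of the product is the first with both factors exchanged, so
    renaming the index pairs turns it into \<open>L\<close> with the functionals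
    interchanged.\<close>
  also have "(\<Sum>i<N. \<Sum>j<n. \<Sum>k<N. \<Sum>l<n.
      \<eta> (t (x k) (e l)) * \<xi> (t (x i) (e j)) * \<zeta> (t (zm (y k) (y i)) (pm (f l) (f j)))) = L \<eta> \<xi>"
    unfolding L_def by (subst sum_swap_pairs) (intro sum.cong refl sum.swap)
  finally show ?thesis .
qed

lemma form_sharp_action:
  assumes \<xi>: "\<xi> \<in> carr (dual C)" and \<eta>: "\<eta> \<in> carr (dual C)"
  shows "\<zeta> (sharp C r_hat (neg_u_dual C mult (sharp C r_hat \<xi>) \<eta>)) = P \<xi> \<eta> - R \<eta> \<xi>"
proof -
  interpret rep: comm_assoc_representation C mult "dual C" "neg_u_dual C mult"
    by (rule dual_representation)
  have T: "sharp C r_hat \<xi> \<in> carr C" by (rule linear_map_mem[OF linear_map_sharp_r_hat \<xi>])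
  note act = bilinear_map_mem[OF rep.action_bilinear T \<eta>]
  note \<eta>_add = linear_map_add[OF dual_linear[OF \<eta>]]
  have "\<zeta> (sharp C r_hat (neg_u_dual C mult (sharp C r_hat \<xi>) \<eta>)) =
      (\<Sum>k<N. \<Sum>l<n. \<eta> (mult (sharp C r_hat \<xi>) (t (x k) (e l))) * \<zeta> (t (y k) (f l)))"
    unfolding form_sharp_r_hat[OF act dual_linear[OF \<zeta>]]
    by (intro sum.cong refl) (simp add: neg_u_dual_def mem)
  also have "\<dots> = (\<Sum>k<N. \<Sum>l<n. (\<Sum>i<N. \<Sum>j<n. \<xi> (t (x i) (e j)) *
      \<eta> (mult (t (y i) (f j)) (t (x k) (e l)))) * \<zeta> (t (y k) (f l)))"
    by (intro sum.cong refl arg_cong[of _ _ "\<lambda>z. z * _"]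
        form_sharp_r_hat[OF \<xi> linear_map_compose[OF mult_left dual_linear[OF \<eta>]]]) (auto intro!: mem)
  also have "\<dots> = (\<Sum>k<N. \<Sum>l<n. \<Sum>i<N. \<Sum>j<n.
      \<xi> (t (x i) (e j)) * \<eta> (t (zm (y i) (x k)) (pm (f j) (e l))) * \<zeta> (t (y k) (f l)) +
      \<xi> (t (x i) (e j)) * \<eta> (t (zm (x k) (y i)) (pm (e l) (f j))) * \<zeta> (t (y k) (f l)))"
    unfolding sum_distrib_right
    by (intro sum.cong refl) (simp add: mult_tens mem \<eta>_add algebra_simps)
  also have "\<dots> = (\<Sum>i<N. \<Sum>j<n. \<Sum>k<N. \<Sum>l<n.
      \<xi> (t (x i) (e j)) * \<eta> (t (zm (y i) (x k)) (pm (f j) (e l))) * \<zeta> (t (y k) (f l)) +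
      \<xi> (t (x i) (e j)) * \<eta> (t (zm (x k) (y i)) (pm (e l) (f j))) * \<zeta> (t (y k) (f l)))"
    by (rule sum_swap_pairs)
  also have "\<dots> = (\<Sum>i<N. \<Sum>k<N. \<Sum>j<n. \<Sum>l<n.
      \<xi> (t (x i) (e j)) * \<eta> (t (zm (y i) (x k)) (pm (f j) (e l))) * \<zeta> (t (y k) (f l)) +
      \<xi> (t (x i) (e j)) * \<eta> (t (zm (x k) (y i)) (pm (e l) (f j))) * \<zeta> (t (y k) (f l)))"
    by (intro sum.cong refl sum.swap)
  also have "\<dots> = (\<Sum>i<N. \<Sum>k<N. \<Sum>j<n. \<Sum>l<n.
      \<xi> (t (x i) (e j)) * \<eta> (t (zm (y i) (x k)) (e l)) * \<zeta> (t (y k) (pm (f j) (f l))) +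
      (\<xi> (t (x i) (e j)) * \<eta> (t (zm (x k) (y i)) (e l)) * \<zeta> (t (y k) (pm (f j) (f l))) -
       \<xi> (t (x i) (e j)) * \<eta> (t (zm (x k) (y i)) (e l)) * \<zeta> (t (y k) (pm (f l) (f j)))))"
  \<comment> \<open>Now \<open>i\<close> and \<open>k\<close> are fixed instead, so the components
    in \<open>A\<close> are constants and the functionals form a trilinear form on \<open>B\<close>.
    The two products in the second slot move to the third by \<open>sum_mult_left\<close> and
    \<open>sum_mult_right\<close>.\<close>
  proof (rule sum.cong[OF refl], rule sum.cong[OF refl])
    fix i k assume ik: "i \<in> {..<N}" "k \<in> {..<N}"
    have tri: "trilinear_form B (\<lambda>b c d. \<xi> (t (x i) b) * \<eta> (t a c) * \<zeta> (t (y k) d))"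
      if "a \<in> carr A" for a
      using \<xi> \<eta> \<zeta> that ik by (intro trilinear_form_mult tens_right) (auto intro!: mem)
    show "(\<Sum>j<n. \<Sum>l<n.
      \<xi> (t (x i) (e j)) * \<eta> (t (zm (y i) (x k)) (pm (f j) (e l))) * \<zeta> (t (y k) (f l)) +
      \<xi> (t (x i) (e j)) * \<eta> (t (zm (x k) (y i)) (pm (e l) (f j))) * \<zeta> (t (y k) (f l))) =
      (\<Sum>j<n. \<Sum>l<n.
      \<xi> (t (x i) (e j)) * \<eta> (t (zm (y i) (x k)) (e l)) * \<zeta> (t (y k) (pm (f j) (f l))) +
      (\<xi> (t (x i) (e j)) * \<eta> (t (zm (x k) (y i)) (e l)) * \<zeta> (t (y k) (pm (f j) (f l))) -
       \<xi> (t (x i) (e j)) * \<eta> (t (zm (x k) (y i)) (e l)) * \<zeta> (t (y k) (pm (f l) (f j)))))"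
      using B.sum_mult_left[OF tri, of "zm (y i) (x k)"] B.sum_mult_right[OF tri, of "zm (x k) (y i)"] ik
      unfolding sum.distrib by (simp add: mem)
  qed
  also have "\<dots> = P \<xi> \<eta> - (\<Sum>i<N. \<Sum>k<N. \<Sum>j<n. \<Sum>l<n.
      \<xi> (t (x i) (e j)) * \<eta> (t (zm (x k) (y i)) (e l)) * \<zeta> (t (y k) (pm (f l) (f j))))"
    unfolding P_def sum_subtractf[symmetric] by (simp add: algebra_simps)
  \<comment> \<open>Exchanging \<open>j\<close> and \<open>l\<close> restores the order
    \<open>pm (f j) (f l)\<close> and puts \<open>\<eta>\<close> first, hence
    \<open>R \<eta> \<xi>\<close> rather than \<open>R \<xi> \<eta>\<close>.\<close>
  also have "(\<Sum>i<N. \<Sum>k<N. \<Sum>j<n. \<Sum>l<n.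
      \<xi> (t (x i) (e j)) * \<eta> (t (zm (x k) (y i)) (e l)) * \<zeta> (t (y k) (pm (f l) (f j)))) = R \<eta> \<xi>"
    unfolding R_def
    by (rule sum.cong[OF refl], rule sum.cong[OF refl], subst sum.swap) (simp add: mult_ac)
  finally show ?thesis .
qed

end

lemma O_operator_sharp_r_hat:
  "O_operator C mult (dual C) (neg_u_dual C mult) (sharp C r_hat)"
proof -
  interpret rep: comm_assoc_representation C mult "dual C" "neg_u_dual C mult"
    by (rule dual_representation)
  note T = linear_map_sharp_r_hat
  show ?thesis
  proof
    show "linear_map (dual C) C (sharp C r_hat)" by (rule T)
    fix \<xi> \<eta> assume \<xi>: "\<xi> \<in> carr (dual C)" and \<eta>: "\<eta> \<in> carr (dual C)"
    let ?\<alpha> = "neg_u_dual C mult (sharp C r_hat \<xi>) \<eta>" and ?\<beta> = "neg_u_dual C mult (sharp C r_hat \<eta>) \<xi>"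
    have act: "?\<alpha> \<in> carr (dual C)" "?\<beta> \<in> carr (dual C)"
      by (intro bilinear_map_mem[OF rep.action_bilinear] linear_map_mem[OF T] \<xi> \<eta>)+
    note sum = linear_map_add[OF T act]
    show "mult (sharp C r_hat \<xi>) (sharp C r_hat \<eta>) = sharp C r_hat (?\<alpha> + ?\<beta>)"
      unfolding sum
    \<comment> \<open>Functionals separate tensors, so it suffices to compare values at
      \<open>\<zeta>\<close>: each side is \<open>P \<xi> \<eta> + P \<eta> \<xi> - R \<xi> \<eta> -
      R \<eta> \<xi>\<close>.\<close>
    proof (rule separatedD[OF vector_space_on_tensor separated_tensor])
      show "\<zeta> (mult (sharp C r_hat \<xi>) (sharp C r_hat \<eta>)) = \<zeta> (sharp C r_hat ?\<alpha> + sharp C r_hat ?\<beta>)"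
        if \<zeta>: "\<zeta> \<in> carr (dual C)" for \<zeta>
        by (simp add: linear_map_add[OF dual_linear[OF \<zeta>]] linear_map_mem[OF T] act
            form_mult_sharp[OF \<zeta> \<xi> \<eta>] form_sharp_action[OF \<zeta>] \<xi> \<eta> L_eq_P_minus_R[OF \<zeta>])
    qed (intro mult_mem add_closed linear_map_mem[OF T] \<xi> \<eta> act)+
  qed
qed

text \<open>Both sides are linear in \<open>\<zeta>\<close>. On a pure tensor the double sum for
  \<open>r_hat\<close> factors by bilinearity. Finite dimension provides the separation that makes
  the two sharps on \<open>A\<close> and \<open>B\<close> explicit.\<close>

lemma sharp_r_hat_tensor:
  assumes A: "fin_dim A" and B: "fin_dim B" and \<zeta>: "\<zeta> \<in> carr (dual A \<otimes>\<^sub>V dual B)"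
  shows "sharp C r_hat (dual_tensor_iso A B \<zeta>) = tensor_map (dual A) (dual B) A B
    (sharp A (\<Sum>i<N. tens A A (x i) (y i))) (sharp B (\<Sum>j<n. tens B B (e j) (f j))) \<zeta>"
proof -
  note vA = A.vector_space_on_axioms and vB = B.vector_space_on_axioms
  note sA = separated_fin_dim[OF vA A] and sB = separated_fin_dim[OF vB B]
  let ?r = "sharp A (\<Sum>i<N. tens A A (x i) (y i))" and ?\<kappa> = "sharp B (\<Sum>j<n. tens B B (e j) (f j))"
  have r: "linear_map (dual A) A ?r" by (rule linear_map_sharp[OF vA sA]) (auto intro: mem)
  have \<kappa>: "linear_map (dual B) B ?\<kappa>" by (rule linear_map_sharp[OF vB sB]) (auto intro: mem)
  have map: "linear_map (dual A \<otimes>\<^sub>V dual B) C (tensor_map (dual A) (dual B) A B ?r ?\<kappa>)"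
    unfolding tensor_map_def
    by (intro linear_map_tensor_lift vector_space_on_dual vector_space_on_tensor bilinear_mapI
        linear_map_compose[OF r bilinear_map_left[OF bilinear_map_tens]]
        linear_map_compose[OF \<kappa> bilinear_map_right[OF bilinear_map_tens]]
        linear_map_mem[OF r] linear_map_mem[OF \<kappa>]) simp_all
  show ?thesis
    using \<zeta>
  proof (rule linear_map_tensor_eqI[OF
        linear_map_compose[OF linear_map_dual_tensor_iso linear_map_sharp_r_hat] map, rotated])
    fix \<xi> \<eta> assume h: "\<xi> \<in> carr (dual A)" "\<eta> \<in> carr (dual B)"
    have "sharp C r_hat (dual_tensor_iso A B (tens (dual A) (dual B) \<xi> \<eta>)) =
        (\<Sum>i<N. \<Sum>j<n. scl C (\<xi> (x i) * \<eta> (e j)) (t (y i) (f j)))"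
      \<comment> \<open>The scaling of \<open>C\<close> stays folded so that
        \<open>bilinear_map_sum_scale\<close> matches in the next step.\<close>
      by (simp add: dual_tensor_iso_tens h sharp_r_hat functional_tensor_in_dual functional_tensor_tens mem
          del: scl_tensor_space)
    also have "\<dots> = t (\<Sum>i<N. scl A (\<xi> (x i)) (y i)) (\<Sum>j<n. scl B (\<eta> (e j)) (f j))"
      by (subst bilinear_map_sum_scale[OF vA vB vector_space_on_tensor bilinear_map_tens])
        (auto intro: mem)
    also have "\<dots> = t (?r \<xi>) (?\<kappa> \<eta>)"
      by (subst sharp_sum[OF vA sA h(1)] sharp_sum[OF vB sB h(2)], auto intro: mem)+
    also have "\<dots> = tensor_map (dual A) (dual B) A B ?r ?\<kappa> (tens (dual A) (dual B) \<xi> \<eta>)"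
      by (rule tensor_map_tens[OF vector_space_on_dual vector_space_on_dual r \<kappa> h, symmetric])
    finally show "sharp C r_hat (dual_tensor_iso A B (tens (dual A) (dual B) \<xi> \<eta>)) =
        tensor_map (dual A) (dual B) A B ?r ?\<kappa> (tens (dual A) (dual B) \<xi> \<eta>)" .
  qed
qed

end

text \<open>The bijectivity conjunct is what entitles \<open>dual_tensor_iso\<close> to be called an
  identification: every functional on the tensor product is reached by exactly one
  \<open>\<zeta>\<close>.\<close>

theorem proposition3p20:
  fixes A :: "('k::field_char_0, 'a::ab_group_add) vec_space"
    and B :: "('k, 'b::ab_group_add) vec_space"
    and zm :: "'a \<Rightarrow> 'a \<Rightarrow> 'a" and pm :: "'b \<Rightarrow> 'b \<Rightarrow> 'b" and \<omega> :: "'b \<Rightarrow> 'b \<Rightarrow> 'k"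
    and x y :: "nat \<Rightarrow> 'a" and N :: nat and r :: "('k, 'a, 'a) tensor"
    and e f :: "nat \<Rightarrow> 'b" and n :: nat and \<kappa> :: "('k, 'b, 'b) tensor"
    and rh :: "('k, ('k, 'a, 'b) tensor, ('k, 'a, 'b) tensor) tensor"
  assumes "zinbiel_algebra A zm" and "fin_dim A"
    and "quadratic_perm_algebra B pm \<omega>" and "fin_dim B"
    and "\<And>i. i < N \<Longrightarrow> x i \<in> carr A" and "\<And>i. i < N \<Longrightarrow> y i \<in> carr A"
    and "r = (\<Sum>i<N. tens A A (x i) (y i))"
    and "tensor_flip A A r = r" and "zinbiel_YB A zm N x y = 0"
    and "is_basis B n e" and "is_basis B n f"
    and "\<And>i j. i < n \<Longrightarrow> j < n \<Longrightarrow> \<omega> (f i) (e j) = (if i = j then 1 else 0)"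
    and "rh = (\<Sum>i<N. \<Sum>j<n. tens (A \<otimes>\<^sub>V B) (A \<otimes>\<^sub>V B)
           (tens A B (x i) (e j)) (tens A B (y i) (f j)))"
    and "\<kappa> = (\<Sum>j<n. tens B B (e j) (f j))"
  shows "O_operator (A \<otimes>\<^sub>V B) (induced_mult A B zm pm)
           (dual (A \<otimes>\<^sub>V B)) (neg_u_dual (A \<otimes>\<^sub>V B) (induced_mult A B zm pm))
           (sharp (A \<otimes>\<^sub>V B) rh) \<and>
         bij_betw (dual_tensor_iso A B) (carr (dual A \<otimes>\<^sub>V dual B)) (carr (dual (A \<otimes>\<^sub>V B))) \<and>
         (\<forall>\<zeta>\<in>carr (dual A \<otimes>\<^sub>V dual B).
           sharp (A \<otimes>\<^sub>V B) rh (dual_tensor_iso A B \<zeta>) =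
           tensor_map (dual A) (dual B) A B (sharp A r) (sharp B \<kappa>) \<zeta>)"
proof -
  interpret zinbiel_YB_perm A zm B pm \<omega> n e f N x y
    using assms(1,3,5-6,8-12) unfolding assms(7)
    by (intro zinbiel_YB_perm.intro quadratic_perm_dual_bases.intro
        quadratic_perm_dual_bases_axioms.intro zinbiel_YB_perm_axioms.intro)
  have "rh = r_hat" by (simp add: assms(13) r_hat_def)
  then show ?thesis
    using O_operator_sharp_r_hat sharp_r_hat_tensor[OF assms(2,4)] assms(7,14)
      bij_betw_dual_tensor_iso[OF A.vector_space_on_axioms assms(2) B.vector_space_on_axioms assms(4)]
    by simp
qed

end
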